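(* Let $X$ be a Tychonoff space which is a sequential $\mu$-space. Then the free locally convex space $L(X)$ over $X$ has the sequential Dunford--Pettis property if and only if $X$ is discrete.
   Context: Locally convex spaces (lcs) are real and Hausdorff; Tychonoff means completely regular and Hausdorff. The free locally convex space over a Tychonoff space $X$ is an lcs $L(X)$ with a continuous map $i:X\to L(X)$ such that for every continuous map $f$ from $X$ to an lcs $E$ there is a unique continuous linear operator $\bar f:L(X)\to E$ with $f=\bar f\circ i$. It exists and is essentially unique, and $i$ is a topological embedding whose image is a Hamel basis of $L(X)$. A subset $A$ of $X$ is functionally bounded in $X$ if every continuous $f:X\to\mathbb{R}$ is bounded on $A$; $X$ is a $\mu$-space if every functionally bounded subset of $X$ has compact closure. $X$ is sequential if for each non-closed subset $A\subseteq X$ there is a sequence in $A$ converging to some point of $\overline{A}\setminus A$. For an lcs $E$ with dual $E'$, $E'_\beta$ denotes $E'$ with the strong topology $\beta(E',E)$ (uniform convergence on bounded subsets of $E$). $E$ has the sequential Dunford--Pettis property if, whenever $\{x_n\}_{n\in\mathbb{N}}$ is a weakly null sequence in $E$ and $\{\chi_n\}_{n\in\mathbb{N}}$ is a weakly null sequence in the lcs $E'_\beta$, then $\lim_n\chi_n(x_n)=0$. *)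

theory Defs
  imports "HOL-Analysis.Analysis" "HOL-Library.Function_Algebras"
begin

text \<open>The dual of a space is a set of functions, and the dual of the strong dual is needed as well,
  so that functions are made a real vector space under the pointwise operations.\<close>

instantiation "fun" :: (type, real_vector) real_vector
begin

definition "c *\<^sub>R f = (\<lambda>x. c *\<^sub>R f x)"

instance
  by standard (simp_all add: scaleR_fun_def plus_fun_def fun_eq_iff algebra_simps)

end


section \<open>Locally convex spaces\<close>

text \<open>A locally convex space is given by its topology alone: the underlying vector space is
  the topspace, a linear subspace of an ambient real vector space.  Only the vector
  operations of the ambient type are used; if it carries a topology, that plays no role.\<close>

definition lcs :: "'v::real_vector topology \<Rightarrow> bool" where
  "lcs E \<longleftrightarrow>
     subspace (topspace E) \<and>
     continuous_map (prod_topology E E) E (\<lambda>(x, y). x + y) \<and>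
     continuous_map (prod_topology euclideanreal E) E (\<lambda>(c, x). c *\<^sub>R x) \<and>
     Hausdorff_space E \<and>
     neighbourhood_base_at 0 convex E"

text \<open>The value 0 outside the domain makes distinct elements of the set below distinct operators,
  and makes the set closed under the pointwise vector operations.\<close>

definition continuous_linear_ops ::
    "'v::real_vector topology \<Rightarrow> 'w::real_vector topology \<Rightarrow> ('v \<Rightarrow> 'w) set" where
  "continuous_linear_ops E F =
     {T. continuous_map E F T \<and>
         (\<forall>x\<in>topspace E. \<forall>y\<in>topspace E. T (x + y) = T x + T y) \<and>
         (\<forall>c. \<forall>x\<in>topspace E. T (c *\<^sub>R x) = c *\<^sub>R T x) \<and>
         (\<forall>x. x \<notin> topspace E \<longrightarrow> T x = 0)}"

definition dual :: "'v::real_vector topology \<Rightarrow> ('v \<Rightarrow> real) set" where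
  "dual E = continuous_linear_ops E euclideanreal"

text \<open>Boundedness in the sense of topological vector spaces, not the metric \<open>bounded\<close>.\<close>

definition vn_bounded :: "'v::real_vector topology \<Rightarrow> 'v set \<Rightarrow> bool" where
  "vn_bounded E B \<longleftrightarrow> B \<subseteq> topspace E \<and>
     (\<forall>U. openin E U \<and> 0 \<in> U \<longrightarrow> (\<exists>s>0. \<forall>t>s. B \<subseteq> (*\<^sub>R) t ` U))"

text \<open>Uniform convergence on bounded sets.  As finite unions of bounded sets are bounded, the sets
  \<open>{g \<in> dual E. \<forall>x\<in>B. \<bar>g x - f x\<bar> < e}\<close> form a neighbourhood base at \<open>f\<close>; they
  need not be open themselves.\<close>

definition strong_dual :: "'v::real_vector topology \<Rightarrow> ('v \<Rightarrow> real) topology" where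
  "strong_dual E = topology (\<lambda>U. U \<subseteq> dual E \<and>
     (\<forall>f\<in>U. \<exists>B e. vn_bounded E B \<and> e > 0 \<and> {g \<in> dual E. \<forall>x\<in>B. \<bar>g x - f x\<bar> < e} \<subseteq> U))"

definition weak_topology :: "'v::real_vector topology \<Rightarrow> 'v topology" where
  "weak_topology E =
     topology_generated_by {{x \<in> topspace E. f x \<in> U} |f U. f \<in> dual E \<and> open U}"

definition weakly_null :: "'v::real_vector topology \<Rightarrow> (nat \<Rightarrow> 'v) \<Rightarrow> bool" where
  "weakly_null E x \<longleftrightarrow> range x \<subseteq> topspace E \<and> limitin (weak_topology E) x 0 sequentially"

definition sequential_Dunford_Pettis :: "'v::real_vector topology \<Rightarrow> bool" where
  "sequential_Dunford_Pettis E \<longleftrightarrow>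
     (\<forall>x \<phi>. weakly_null E x \<and> weakly_null (strong_dual E) \<phi> \<longrightarrow> (\<lambda>n. \<phi> n (x n)) \<longlonglongrightarrow> 0)"


section \<open>Classes of topological spaces\<close>

definition tychonoff_space :: "'a topology \<Rightarrow> bool" where
  "tychonoff_space X \<longleftrightarrow> completely_regular_space X \<and> Hausdorff_space X"

definition functionally_bounded :: "'a topology \<Rightarrow> 'a set \<Rightarrow> bool" where
  "functionally_bounded X A \<longleftrightarrow> A \<subseteq> topspace X \<and>
     (\<forall>f::'a \<Rightarrow> real. continuous_map X euclideanreal f \<longrightarrow> bounded (f ` A))"

definition mu_space :: "'a topology \<Rightarrow> bool" where
  "mu_space X \<longleftrightarrow> (\<forall>A. functionally_bounded X A \<longrightarrow> compactin X (X closure_of A))"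

definition sequential_space :: "'a topology \<Rightarrow> bool" where
  "sequential_space X \<longleftrightarrow>
     (\<forall>A \<subseteq> topspace X. \<not> closedin X A \<longrightarrow>
        (\<exists>s a. range s \<subseteq> A \<and> a \<in> X closure_of A - A \<and> limitin X s a sequentially))"


section \<open>Free locally convex spaces\<close>

text \<open>A formula cannot quantify over types, so the universal property is required for the
  locally convex spaces on subspaces of one type, \<open>('a + 'v) \<Rightarrow> real\<close>.  It is large enough:
  only the subspace spanned by an image of \<open>X\<close> and an image of \<open>L\<close> matters, and every such span embeds
  linearly in that type.  Theorem \<open>free_lcs_universal\<close> below derives from this definition the
  universal property for locally convex spaces on arbitrary types.\<close>

definition free_lcs :: "'a topology \<Rightarrow> 'v::real_vector topology \<Rightarrow> ('a \<Rightarrow> 'v) \<Rightarrow> bool" where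
  "free_lcs X L i \<longleftrightarrow> lcs L \<and> continuous_map X L i \<and>
     (\<forall>(E :: ('a + 'v \<Rightarrow> real) topology) f. lcs E \<and> continuous_map X E f \<longrightarrow>
        (\<exists>!T. T \<in> continuous_linear_ops L E \<and> (\<forall>x\<in>topspace X. T (i x) = f x)))"


subsection \<open>The topologies defined above\<close>

lemma continuous_linear_ops_zero: "lcs E \<Longrightarrow> T \<in> continuous_linear_ops E F \<Longrightarrow> T 0 = 0"
  unfolding continuous_linear_ops_def lcs_def
  by (metis (mono_tags, lifting) mem_Collect_eq scale_zero_left subspace_0)

lemma zero_in_continuous_linear_ops: "lcs F \<Longrightarrow> (\<lambda>x. 0) \<in> continuous_linear_ops E F"
  unfolding continuous_linear_ops_def lcs_def by (auto simp: subspace_0)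

lemma zero_in_dual: "(\<lambda>x. 0) \<in> dual E"
  unfolding dual_def continuous_linear_ops_def by auto

lemma vn_bounded_Un:
  assumes "vn_bounded E A" "vn_bounded E B" shows "vn_bounded E (A \<union> B)"
  unfolding vn_bounded_def
proof (intro conjI allI impI)
  show "A \<union> B \<subseteq> topspace E" using assms by (auto simp: vn_bounded_def)
  fix U assume U: "openin E U \<and> 0 \<in> U"
  obtain s where s: "s > 0" "\<forall>t>s. A \<subseteq> (*\<^sub>R) t ` U" using assms(1) U unfolding vn_bounded_def by blast
  obtain r where r: "r > 0" "\<forall>t>r. B \<subseteq> (*\<^sub>R) t ` U" using assms(2) U unfolding vn_bounded_def by blast
  show "\<exists>s>0. \<forall>t>s. A \<union> B \<subseteq> (*\<^sub>R) t ` U"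
    using s r by (intro exI[of _ "max s r"]) auto
qed

lemma openin_strong_dual:
  "openin (strong_dual E) U \<longleftrightarrow> U \<subseteq> dual E \<and>
     (\<forall>f\<in>U. \<exists>B e. vn_bounded E B \<and> e > 0 \<and> {g \<in> dual E. \<forall>x\<in>B. \<bar>g x - f x\<bar> < e} \<subseteq> U)"
proof -
  define N where "N = (\<lambda>f B e. {g \<in> dual E. \<forall>x\<in>B. \<bar>g x - f x\<bar> < (e::real)})"
  define P where "P = (\<lambda>U. U \<subseteq> dual E \<and> (\<forall>f\<in>U. \<exists>B e. vn_bounded E B \<and> e > 0 \<and> N f B e \<subseteq> U))"
  have "istopology P"
    unfolding istopology_def
  proof (intro conjI allI impI)
    fix S T assume S: "P S" and T: "P T"
    show "P (S \<inter> T)"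
      unfolding P_def
    proof (intro conjI ballI)
      show "S \<inter> T \<subseteq> dual E" using S by (auto simp: P_def)
      fix f assume f: "f \<in> S \<inter> T"
      obtain A a where A: "vn_bounded E A" "a > 0" "N f A a \<subseteq> S"
        using S f unfolding P_def by blast
      obtain B b where B: "vn_bounded E B" "b > 0" "N f B b \<subseteq> T"
        using T f unfolding P_def by blast
      have "N f (A \<union> B) (min a b) \<subseteq> S \<inter> T"
        using A(3) B(3) by (auto simp: N_def)
      then show "\<exists>B e. vn_bounded E B \<and> e > 0 \<and> N f B e \<subseteq> S \<inter> T"
        using vn_bounded_Un[OF A(1) B(1)] A(2) B(2) by (metis min_less_iff_conj)
    qed
  next
    fix K assume "\<forall>S\<in>K. P S"
    then show "P (\<Union>K)"
      unfolding P_def by (meson Sup_le_iff Union_iff Union_upper order_trans)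
  qed
  then show ?thesis
    unfolding strong_dual_def by (simp add: topology_inverse' P_def N_def)
qed

lemma topspace_strong_dual [simp]: "topspace (strong_dual E) = dual E"
proof -
  have "vn_bounded E {}" by (auto simp: vn_bounded_def intro: exI[of _ 1])
  then have "openin (strong_dual E) (dual E)"
    unfolding openin_strong_dual by (auto intro!: exI[of _ "{}"] exI[of _ 1])
  then show ?thesis
    by (metis openin_strong_dual openin_subset openin_topspace subset_antisym)
qed

lemma weakly_null_iff:
  assumes "lcs E"
  shows "weakly_null E x \<longleftrightarrow> range x \<subseteq> topspace E \<and> (\<forall>f\<in>dual E. (\<lambda>n. f (x n)) \<longlonglongrightarrow> 0)"
proof -
  let ?S = "{{x \<in> topspace E. f x \<in> U} |f U. f \<in> dual E \<and> open U}"
  have z: "0 \<in> topspace E" using assms by (simp add: lcs_def subspace_0)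
  have ts: "topspace (weak_topology E) = topspace E"
  proof -
    have "topspace E \<in> ?S" using zero_in_dual[of E] by (auto intro!: exI[of _ "\<lambda>x. 0"] exI[of _ UNIV])
    then show ?thesis unfolding weak_topology_def topology_generated_by_topspace by blast
  qed
  have f0: "f 0 = 0" if "f \<in> dual E" for f
    using that assms continuous_linear_ops_zero unfolding dual_def by blast
  have "limitin (weak_topology E) x 0 sequentially \<longleftrightarrow> (\<forall>f\<in>dual E. (\<lambda>n. f (x n)) \<longlonglongrightarrow> 0)"
    if r: "range x \<subseteq> topspace E"
  proof
    assume lim: "limitin (weak_topology E) x 0 sequentially"
    show "\<forall>f\<in>dual E. (\<lambda>n. f (x n)) \<longlonglongrightarrow> 0"
    proof
      fix f assume f: "f \<in> dual E"
      show "(\<lambda>n. f (x n)) \<longlonglongrightarrow> 0"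
      proof (rule topological_tendstoI)
        fix U :: "real set" assume U: "open U" "0 \<in> U"
        have "openin (weak_topology E) {x \<in> topspace E. f x \<in> U}"
          unfolding weak_topology_def using f U by (auto intro!: topology_generated_by_Basis)
        then have "eventually (\<lambda>n. x n \<in> {x \<in> topspace E. f x \<in> U}) sequentially"
          using lim z U f0[OF f] by (auto simp: limitin_def)
        then show "eventually (\<lambda>n. f (x n) \<in> U) sequentially"
          by (auto elim: eventually_mono)
      qed
    qed
  next
    assume lim: "\<forall>f\<in>dual E. (\<lambda>n. f (x n)) \<longlonglongrightarrow> 0"
    have ev: "eventually (\<lambda>n. x n \<in> U) sequentially"
      if "generate_topology_on ?S U" "0 \<in> U" for U
      using that
    proof (induction rule: generate_topology_on.induct)
      case (Int a b)
      then show ?case by (auto intro: eventually_conj)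
    next
      case (UN K)
      then obtain k where k: "k \<in> K" "0 \<in> k" by blast
      then have "eventually (\<lambda>n. x n \<in> k) sequentially" using UN.IH by blast
      then show ?case using k(1) by (auto elim!: eventually_mono)
    next
      case (Basis s)
      then obtain f U where s: "s = {x \<in> topspace E. f x \<in> U}" "f \<in> dual E" "open U" by blast
      have "(\<lambda>n. f (x n)) \<longlonglongrightarrow> 0" using lim s(2) by blast
      moreover have "0 \<in> U" using Basis.prems s(1) f0[OF s(2)] by simp
      ultimately have "eventually (\<lambda>n. f (x n) \<in> U) sequentially"
        using s(3) topological_tendstoD by blast
      then show ?case unfolding s(1) using r by (auto elim!: eventually_mono)
    qed simp
    then show "limitin (weak_topology E) x 0 sequentially"
      unfolding limitin_def ts using z
      by (simp add: weak_topology_def openin_topology_generated_by_iff)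
  qed
  then show ?thesis unfolding weakly_null_def by blast
qed


subsection \<open>The universal property on arbitrary types\<close>

lemma lcs_pullback:
  fixes E :: "'v::real_vector topology" and K :: "'w::real_vector \<Rightarrow> 'v"
  assumes E: "lcs E" and A: "subspace A" and KA: "K ` A \<subseteq> topspace E" and inj: "inj_on K A"
    and add: "\<And>x y. x \<in> A \<Longrightarrow> y \<in> A \<Longrightarrow> K (x + y) = K x + K y"
    and scale: "\<And>c x. x \<in> A \<Longrightarrow> K (c *\<^sub>R x) = c *\<^sub>R K x"
  shows "lcs (pullback_topology A K E)"
proof -
  let ?F = "pullback_topology A K E"
  have ts: "topspace ?F = A" using KA by (auto simp: topspace_pullback_topology)
  have K: "continuous_map ?F E K"
    using continuous_map_pullback[OF continuous_map_id, of A K E] by simp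
  have "continuous_map (prod_topology ?F ?F) E ((\<lambda>(x, y). x + y) \<circ> (\<lambda>p. (K (fst p), K (snd p))))"
  proof (rule continuous_map_compose)
    show "continuous_map (prod_topology ?F ?F) (prod_topology E E) (\<lambda>p. (K (fst p), K (snd p)))"
      using continuous_map_compose[OF continuous_map_fst K] continuous_map_compose[OF continuous_map_snd K]
      by (intro continuous_map_pairedI) (auto simp: o_def)
    show "continuous_map (prod_topology E E) E (\<lambda>(x, y). x + y)" using E by (simp add: lcs_def)
  qed
  then have "continuous_map (prod_topology ?F ?F) E (K \<circ> (\<lambda>(x, y). x + y))"
    by (rule continuous_map_eq) (auto simp: ts add)
  then have 1: "continuous_map (prod_topology ?F ?F) ?F (\<lambda>(x, y). x + y)"
    by (rule continuous_map_pullback') (auto simp: ts A subspace_add)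
  have "continuous_map (prod_topology euclideanreal ?F) E
      ((\<lambda>(c, x). c *\<^sub>R x) \<circ> (\<lambda>p. (fst p, K (snd p))))"
  proof (rule continuous_map_compose)
    show "continuous_map (prod_topology euclideanreal ?F) (prod_topology euclideanreal E)
        (\<lambda>p. (fst p, K (snd p)))"
      using continuous_map_compose[OF continuous_map_snd K]
      by (intro continuous_map_pairedI) (auto simp: o_def continuous_map_fst)
    show "continuous_map (prod_topology euclideanreal E) E (\<lambda>(c, x). c *\<^sub>R x)"
      using E by (simp add: lcs_def)
  qed
  then have "continuous_map (prod_topology euclideanreal ?F) E (K \<circ> (\<lambda>(c, x). c *\<^sub>R x))"
    by (rule continuous_map_eq) (auto simp: ts scale)
  then have 2: "continuous_map (prod_topology euclideanreal ?F) ?F (\<lambda>(c, x). c *\<^sub>R x)"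
    by (rule continuous_map_pullback') (auto simp: ts A subspace_scale)
  have 3: "Hausdorff_space ?F"
    using Hausdorff_space_injective_preimage[OF _ K] E inj by (simp add: ts lcs_def)
  have K0: "K 0 = 0" using scale[of 0 0] A by (simp add: subspace_0)
  have 4: "neighbourhood_base_at 0 convex ?F"
    unfolding neighbourhood_base_at_def
  proof (intro allI impI)
    fix W assume "openin ?F W \<and> 0 \<in> W"
    then obtain U where U: "openin E U" "W = K -` U \<inter> A" "0 \<in> U"
      using K0 by (auto simp: openin_pullback_topology)
    then obtain O' C where C: "openin E O'" "convex C" "0 \<in> O'" "O' \<subseteq> C" "C \<subseteq> U"
      using E unfolding lcs_def neighbourhood_base_at_def by blast
    have "convex (K -` C \<inter> A)"
      using C(2) A unfolding convex_def by (auto simp: add scale subspace_scale subspace_add)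
    moreover have "openin ?F (K -` O' \<inter> A)" using C(1) by (auto simp: openin_pullback_topology)
    moreover have "0 \<in> K -` O' \<inter> A" using C(3) K0 A by (simp add: subspace_0)
    ultimately show "\<exists>U V. openin ?F U \<and> convex V \<and> 0 \<in> U \<and> U \<subseteq> V \<and> V \<subseteq> W"
      using C(4,5) U(2) by (intro exI[of _ "K -` O' \<inter> A"] exI[of _ "K -` C \<inter> A"]) auto
  qed
  show ?thesis unfolding lcs_def ts using A 1 2 3 4 by blast
qed

text \<open>The span of a family embeds linearly in the real functions on its index type.\<close>

lemma span_embedding:
  fixes h :: "'k \<Rightarrow> 'e::real_vector"
  obtains J :: "'e \<Rightarrow> 'k \<Rightarrow> real"
  where "inj_on J (span (range h))"
    "\<And>x y. x \<in> span (range h) \<Longrightarrow> y \<in> span (range h) \<Longrightarrow> J (x + y) = J x + J y"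
    "\<And>c x. x \<in> span (range h) \<Longrightarrow> J (c *\<^sub>R x) = c *\<^sub>R J x"
proof -
  obtain B where B: "B \<subseteq> range h" "independent B" "range h \<subseteq> span B"
    using maximal_independent_subset by blast
  have sB: "span (range h) = span B"
    using B by (meson span_mono span_span subset_antisym span_minimal subspace_span)
  let ?J = "\<lambda>v k. representation B v (h k)"
  show ?thesis
  proof
    show "inj_on ?J (span (range h))"
    proof
      fix x y assume x: "x \<in> span (range h)" and y: "y \<in> span (range h)" and eq: "?J x = ?J y"
      have "representation B x b = representation B y b" for b
      proof (cases "b \<in> B")
        case True
        then show ?thesis using B(1) fun_cong[OF eq] by auto
      next
        case False
        then show ?thesis using representation_ne_zero by metis
      qed
      then have "representation B x = representation B y" by blast
      then show "x = y" using sum_nonzero_representation_eq[OF B(2)] x y sB by metis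
    qed
    show "?J (x + y) = ?J x + ?J y" if "x \<in> span (range h)" "y \<in> span (range h)" for x y
      using that B(2) by (simp add: sB representation_add plus_fun_def)
    show "?J (c *\<^sub>R x) = c *\<^sub>R ?J x" if "x \<in> span (range h)" for c x
      using that B(2) by (simp add: sB representation_scale scaleR_fun_def)
  qed
qed

lemma lcs_copy:
  fixes E :: "'e::real_vector topology" and h :: "'k \<Rightarrow> 'e"
  assumes E: "lcs E" and h: "range h \<subseteq> topspace E"
  obtains F :: "('k \<Rightarrow> real) topology" and J K where "lcs F"
    "J \<in> continuous_linear_ops (subtopology E (span (range h))) F"
    "K \<in> continuous_linear_ops F E"
    "\<And>v. v \<in> span (range h) \<Longrightarrow> K (J v) = v"
proof -
  let ?W = "span (range h)"
  have W: "?W \<subseteq> topspace E" using E h by (simp add: lcs_def span_minimal)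
  obtain J :: "'e \<Rightarrow> 'k \<Rightarrow> real" where inj: "inj_on J ?W"
    and Ja: "\<And>x y. x \<in> ?W \<Longrightarrow> y \<in> ?W \<Longrightarrow> J (x + y) = J x + J y"
    and Js: "\<And>c x. x \<in> ?W \<Longrightarrow> J (c *\<^sub>R x) = c *\<^sub>R J x"
    using span_embedding[of h] by metis
  define J' where "J' = (\<lambda>v. if v \<in> ?W then J v else 0)"
  define K where "K = (\<lambda>u. if u \<in> J ` ?W then inv_into ?W J u else 0)"
  define F where "F = pullback_topology (J ` ?W) K E"
  have KJ: "K (J v) = v" if "v \<in> ?W" for v using that inj by (simp add: K_def)
  have add: "K (x + y) = K x + K y" if xy: "x \<in> J ` ?W" "y \<in> J ` ?W" for x y
  proof -
    obtain v w where vw: "v \<in> ?W" "w \<in> ?W" "x = J v" "y = J w" using xy by blast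
    then have "x + y = J (v + w)" by (simp add: Ja)
    then show ?thesis using vw KJ by (simp add: span_add)
  qed
  have scale: "K (c *\<^sub>R x) = c *\<^sub>R K x" if x: "x \<in> J ` ?W" for c x
  proof -
    obtain v where v: "v \<in> ?W" "x = J v" using x by blast
    then have "c *\<^sub>R x = J (c *\<^sub>R v)" by (simp add: Js)
    then show ?thesis using v KJ by (simp add: span_scale)
  qed
  have sub: "subspace (J ` ?W)"
    unfolding subspace_def
  proof (intro conjI allI ballI)
    show "0 \<in> J ` ?W" using Js[of 0 0] by (metis imageI scale_zero_left span_zero)
    show "x + y \<in> J ` ?W" if "x \<in> J ` ?W" "y \<in> J ` ?W" for x y
      using that by (auto simp flip: Ja intro: span_add)
    show "c *\<^sub>R x \<in> J ` ?W" if "x \<in> J ` ?W" for c x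
      using that by (auto simp flip: Js intro: span_scale)
  qed
  have KW: "K ` J ` ?W \<subseteq> topspace E" using W KJ by auto
  have "inj_on K (J ` ?W)" using KJ by (auto intro!: inj_onI)
  then have F: "lcs F" unfolding F_def using lcs_pullback[OF E sub KW] add scale by blast
  have tF: "topspace F = J ` ?W" using KW by (auto simp: F_def topspace_pullback_topology)
  have "continuous_map F E K"
    unfolding F_def using continuous_map_pullback[OF continuous_map_id, of "J ` ?W" K E] by simp
  then have K: "K \<in> continuous_linear_ops F E"
    unfolding continuous_linear_ops_def tF using add scale by (auto simp: K_def)
  have tW: "topspace (subtopology E ?W) = ?W" using W by auto
  have "continuous_map (subtopology E ?W) E (K \<circ> J')"
    by (rule continuous_map_eq[of _ _ "\<lambda>x. x"]) (auto simp: J'_def KJ continuous_map_from_subtopology)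
  then have "continuous_map (subtopology E ?W) F J'"
    unfolding F_def by (rule continuous_map_pullback') (auto simp: J'_def)
  then have J': "J' \<in> continuous_linear_ops (subtopology E ?W) F"
    unfolding continuous_linear_ops_def tW
    by (auto simp: J'_def Ja Js span_add span_scale)
  show ?thesis by (rule that[OF F J' K]) (simp add: J'_def KJ)
qed

lemma continuous_linear_ops_compose:
  assumes "lcs F" "lcs G" "S \<in> continuous_linear_ops E F" "T \<in> continuous_linear_ops F G"
  shows "T \<circ> S \<in> continuous_linear_ops E G"
proof -
  have "T 0 = 0" using continuous_linear_ops_zero assms by blast
  moreover have "S x \<in> topspace F" if "x \<in> topspace E" for x
    using assms(3) that by (auto simp: continuous_linear_ops_def continuous_map_def)
  ultimately show ?thesis
    using assms(3,4) unfolding continuous_linear_ops_def by (auto intro: continuous_map_compose)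
qed

theorem free_lcs_universal:
  fixes X :: "'a topology" and L :: "'v::real_vector topology" and E :: "'e::real_vector topology"
  assumes L: "free_lcs X L i" and E: "lcs E" and f: "continuous_map X E f"
  shows "\<exists>!T. T \<in> continuous_linear_ops L E \<and> (\<forall>x\<in>topspace X. T (i x) = f x)"
proof -
  have lL: "lcs L" and univ: "\<And>(F :: ('a + 'v \<Rightarrow> real) topology) g. lcs F \<Longrightarrow> continuous_map X F g \<Longrightarrow>
      (\<exists>!T. T \<in> continuous_linear_ops L F \<and> (\<forall>x\<in>topspace X. T (i x) = g x))"
    using L unfolding free_lcs_def by blast+
  have zE: "0 \<in> topspace E" using E by (simp add: lcs_def subspace_0)
  have copy: "\<exists>(F :: ('a + 'v \<Rightarrow> real) topology) J K. lcs F \<and>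
      J \<in> continuous_linear_ops (subtopology E (span (range h))) F \<and> K \<in> continuous_linear_ops F E \<and>
      (\<forall>v\<in>span (range h). K (J v) = v)" if "range h \<subseteq> topspace E" for h :: "'a + 'v \<Rightarrow> 'e"
    using lcs_copy[OF E that] by metis
  show ?thesis
  proof (rule ex_ex1I)
    define h :: "'a + 'v \<Rightarrow> 'e" where
      "h = case_sum (\<lambda>x. if x \<in> topspace X then f x else 0) (\<lambda>v. 0)"
    have "range h \<subseteq> topspace E"
      using f zE by (auto simp: h_def continuous_map_def split: sum.split)
    then obtain F :: "('a + 'v \<Rightarrow> real) topology" and J K where F: "lcs F"
      and J: "J \<in> continuous_linear_ops (subtopology E (span (range h))) F"
      and K: "K \<in> continuous_linear_ops F E" and KJ: "\<And>v. v \<in> span (range h) \<Longrightarrow> K (J v) = v"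
      using copy by metis
    have fh: "f x \<in> span (range h)" if "x \<in> topspace X" for x
      using that by (intro span_base range_eqI[of _ _ "Inl x"]) (simp add: h_def)
    have "continuous_map X (subtopology E (span (range h))) f"
      using f fh by (auto simp: continuous_map_in_subtopology)
    then have "continuous_map X F (J \<circ> f)"
      using J by (auto simp: continuous_linear_ops_def intro: continuous_map_compose)
    then obtain T where T: "T \<in> continuous_linear_ops L F" "\<forall>x\<in>topspace X. T (i x) = (J \<circ> f) x"
      using univ[OF F] by blast
    have "K \<circ> T \<in> continuous_linear_ops L E"
      using continuous_linear_ops_compose[OF F E T(1) K] .
    moreover have "\<forall>x\<in>topspace X. (K \<circ> T) (i x) = f x" using T(2) KJ fh by simp
    ultimately show "\<exists>T. T \<in> continuous_linear_ops L E \<and> (\<forall>x\<in>topspace X. T (i x) = f x)" by blast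
  next
    fix S T
    assume "S \<in> continuous_linear_ops L E \<and> (\<forall>x\<in>topspace X. S (i x) = f x)"
      and "T \<in> continuous_linear_ops L E \<and> (\<forall>x\<in>topspace X. T (i x) = f x)"
    then have S: "S \<in> continuous_linear_ops L E" and Sf: "\<And>x. x \<in> topspace X \<Longrightarrow> S (i x) = f x"
      and T: "T \<in> continuous_linear_ops L E" and Tf: "\<And>x. x \<in> topspace X \<Longrightarrow> T (i x) = f x" by blast+
    define D where "D = (\<lambda>v. S v + (-1) *\<^sub>R T v)"
    have cS: "continuous_map L E S" and cT: "continuous_map L E T"
      using S T by (auto simp: continuous_linear_ops_def)
    have "continuous_map L E ((\<lambda>(c, x). c *\<^sub>R x) \<circ> (\<lambda>v. (-1::real, T v)))"
      by (rule continuous_map_compose[where X' = "prod_topology euclideanreal E"])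
        (use cT E in \<open>auto simp: lcs_def intro!: continuous_map_pairedI\<close>)
    then have cT': "continuous_map L E (\<lambda>v. (-1) *\<^sub>R T v)" by (simp add: o_def)
    have "continuous_map L E ((\<lambda>(x, y). x + y) \<circ> (\<lambda>v. (S v, (-1) *\<^sub>R T v)))"
      by (rule continuous_map_compose[where X' = "prod_topology E E"])
        (use cS cT' E in \<open>auto simp: lcs_def intro!: continuous_map_pairedI\<close>)
    then have cD: "continuous_map L E D" by (simp add: o_def D_def)
    have D: "D \<in> continuous_linear_ops L E"
      using S T cD unfolding continuous_linear_ops_def by (auto simp: D_def algebra_simps)
    define h :: "'a + 'v \<Rightarrow> 'e" where "h = case_sum (\<lambda>x. 0) D"
    have Dts: "D v \<in> topspace E" for v
    proof (cases "v \<in> topspace L")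
      case True
      then show ?thesis using cD by (auto simp: continuous_map_def)
    next
      case False
      then show ?thesis using D zE by (auto simp: continuous_linear_ops_def)
    qed
    then have "range h \<subseteq> topspace E" using zE by (auto simp: h_def split: sum.split)
    then obtain F :: "('a + 'v \<Rightarrow> real) topology" and J K where F: "lcs F"
      and J: "J \<in> continuous_linear_ops (subtopology E (span (range h))) F"
      and KJ: "\<And>v. v \<in> span (range h) \<Longrightarrow> K (J v) = v"
      using copy by metis
    have Dh: "D v \<in> span (range h)" for v
      by (intro span_base range_eqI[of _ _ "Inr v"]) (simp add: h_def)
    have tW: "topspace (subtopology E (span (range h))) = span (range h)"
      using \<open>range h \<subseteq> topspace E\<close> E by (auto simp: lcs_def dest: span_minimal)
    have J0: "J 0 = 0"
      using J unfolding continuous_linear_ops_def tW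
      by (metis (mono_tags, lifting) mem_Collect_eq scale_zero_left span_zero)
    have "continuous_map L (subtopology E (span (range h))) D"
      using cD Dh by (auto simp: continuous_map_in_subtopology)
    then have "J \<circ> D \<in> continuous_linear_ops L F"
      using J D J0 Dh unfolding continuous_linear_ops_def tW by (auto intro: continuous_map_compose)
    moreover have "\<forall>x\<in>topspace X. (J \<circ> D) (i x) = 0" using Sf Tf J0 by (simp add: D_def)
    moreover have "(\<lambda>x. 0) \<in> continuous_linear_ops L F" using zero_in_continuous_linear_ops[OF F] .
    moreover have "continuous_map X F (\<lambda>x. 0)" using F by (simp add: lcs_def subspace_0)
    ultimately have "J \<circ> D = (\<lambda>x. 0)" using univ[OF F, of "\<lambda>x. 0"] by blast
    then have "D v = 0" for v using KJ[OF Dh] KJ[OF span_zero] J0 by (metis comp_apply)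
    then show "S = T" by (auto simp: D_def fun_eq_iff)
  qed
qed

end

theory Submission
  imports Defs
begin

text \<open>The dual of \<open>L\<close> is the space of continuous real functions on \<open>X\<close>, a function \<open>f\<close> acting on a
  finite combination of points \<open>\<Sum>p. c p *\<^sub>R i p\<close> by \<open>\<Sum>p. c p * f p\<close>.

  If \<open>X\<close> is discrete, every real function is continuous, so that the functionals on \<open>L\<close> may grow
  arbitrarily fast along the points of \<open>X\<close>.  A weakly null sequence therefore lives on finitely many
  points (\<open>discrete_weakly_null_support_finite\<close>), and the pairing with a weakly null sequence of
  functionals is a fixed finite sum of products of null sequences.

  If \<open>X\<close> is not discrete, sequentiality gives points \<open>s n \<noteq> a\<close> that converge to \<open>a\<close>, and then
  \<open>i (s n) - i a\<close> is weakly null.  A function \<open>h\<close> with \<open>h a = 0 < h (s n)\<close> carries the problem to the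
  real line: along a subsequence the values \<open>h (s n)\<close> shrink so fast that there are tents \<open>g n\<close> with
  disjoint supports, equal to \<open>1\<close> at \<open>h (s n)\<close> and to \<open>0\<close> at \<open>0\<close>.  The functionals \<open>\<xi> n\<close> induced by
  \<open>g n \<circ> h\<close> take the value \<open>1\<close> on \<open>i (s n) - i a\<close>, and it remains to see that they are weakly null in
  the strong dual.  A continuous functional on the strong dual is controlled by a bounded subset of
  \<open>L\<close>; by the uniform boundedness principle, applied on the Banach space of bounded continuous
  functions on the line, it induces a bounded functional there
  (\<open>bidual_comp_bounded_linear\<close>).  Such a functional tends to zero along the tents because their
  signed sums stay in the unit ball.\<close>

section \<open>Uniform boundedness\<close>

text \<open>On a ball around any centre a linear operator is at least as large as on the ball of the same
  radius around \<open>0\<close>, since \<open>2 *\<^sub>R T u = T (x + u) - T (x - u)\<close>.\<close>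

lemma onorm_approximated_on_ball:
  fixes T :: "'a::real_normed_vector \<Rightarrow>\<^sub>L 'b::real_normed_vector"
  assumes r: "r > 0" and C: "C < r * norm T"
  obtains z where "norm (z - x) \<le> r" "C < norm (T z)"
proof -
  have "\<exists>z. norm (z - x) \<le> r \<and> C < norm (T z)"
  proof (rule ccontr)
    assume "\<not> ?thesis"
    then have le: "norm (T z) \<le> C" if "norm (z - x) \<le> r" for z
      using that by force
    have small: "norm (T u) \<le> C" if u: "norm u \<le> r" for u
    proof -
      have "2 *\<^sub>R T u = T (x + u) - T (x - u)"
        by (simp add: blinfun.add_right blinfun.diff_right algebra_simps scaleR_2)
      then have "2 * norm (T u) = norm (T (x + u) - T (x - u))"
        by (metis norm_scaleR abs_numeral)
      also have "\<dots> \<le> norm (T (x + u)) + norm (T (x - u))" by (rule norm_triangle_ineq4)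
      also have "\<dots> \<le> C + C" using u by (intro add_mono le) auto
      finally show ?thesis by simp
    qed
    have "0 \<le> C" using small[of 0] r by simp
    have "norm T \<le> C / r"
    proof (rule norm_blinfun_bound)
      show "0 \<le> C / r" using \<open>0 \<le> C\<close> r by simp
      fix u
      show "norm (T u) \<le> C / r * norm u"
      proof (cases "u = 0")
        case False
        have "norm (T ((r / norm u) *\<^sub>R u)) \<le> C" using False r by (intro small) simp
        then show ?thesis using False r by (simp add: blinfun.scaleR_right field_simps)
      qed simp
    qed
    then show False using C r by (simp add: field_simps)
  qed
  then show ?thesis using that by blast
qed

text \<open>A gliding hump: from operators with \<open>norm (T n) > 4 ^ n\<close> one builds points \<open>z (n + 1)\<close> within
  \<open>3 ^ -n\<close> of \<open>z n\<close> on which \<open>T n\<close> is almost as large as that radius allows.  The later corrections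
  add up to at most half the radius, so that \<open>T n\<close> is still large at the limit, by a factor
  \<open>(4/3) ^ n\<close>.\<close>

theorem uniform_boundedness:
  fixes F :: "('a::banach \<Rightarrow>\<^sub>L 'b::real_normed_vector) set"
  assumes pw: "\<And>x. \<exists>C. \<forall>T\<in>F. norm (T x) \<le> C"
  obtains M where "\<And>T. T \<in> F \<Longrightarrow> norm T \<le> M"
proof -
  have "\<exists>M. \<forall>T\<in>F. norm T \<le> M"
  proof (rule ccontr)
    assume "\<nexists>M. \<forall>T\<in>F. norm T \<le> M"
    then have "\<exists>T. T \<in> F \<and> 4 ^ n < norm T" for n :: nat
      by (meson not_le)
    then obtain T where T: "\<And>n. T n \<in> F" "\<And>n::nat. 4 ^ n < norm (T n)" by metis
    have step: "\<exists>z. norm (z - x) \<le> (1/3) ^ n \<and> 2/3 * (1/3) ^ n * norm (T n) < norm (T n z)" for x n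
    proof -
      have "0 < (1/3::real) ^ n * norm (T n)"
        using T(2)[of n] by (smt (verit) zero_less_power mult_pos_pos zero_less_divide_1_iff)
      then have "2/3 * (1/3) ^ n * norm (T n) < (1/3) ^ n * norm (T n)" by (simp add: field_simps)
      then show ?thesis using onorm_approximated_on_ball[of "(1/3)^n" "2/3 * (1/3) ^ n * norm (T n)" "T n" x]
        by auto
    qed
    have "\<exists>z. \<forall>n. norm (z (Suc n) - z n) \<le> (1/3) ^ n
        \<and> 2/3 * (1/3) ^ n * norm (T n) < norm (T n (z (Suc n)))"
      using dependent_nat_choice[of "\<lambda>_ _. True" "\<lambda>n x z. norm (z - x) \<le> (1/3) ^ n
        \<and> 2/3 * (1/3) ^ n * norm (T n) < norm (T n z)"] step by auto
    then obtain z where z: "\<And>n. norm (z (Suc n) - z n) \<le> (1/3) ^ n"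
      "\<And>n. 2/3 * (1/3) ^ n * norm (T n) < norm (T n (z (Suc n)))" by blast
    have geo: "summable (\<lambda>n. (1/3::real) ^ n)" by (intro summable_geometric) simp
    have "summable (\<lambda>n. z (Suc n) - z n)"
      by (rule summable_comparison_test'[OF geo, of 0]) (use z(1) in auto)
    then obtain l where "(\<lambda>n. z n - z 0) \<longlonglongrightarrow> l"
      unfolding summable_def sums_def sum_lessThan_telescope by blast
    from tendsto_add[OF this tendsto_const, of "z 0"] obtain w where w: "z \<longlonglongrightarrow> w" by auto
    have tail: "norm (w - z (Suc n)) \<le> 1/2 * (1/3) ^ n" for n
    proof -
      have "norm (z (Suc n + k) - z (Suc n)) \<le> 1/2 * (1/3) ^ n * (1 - (1/3) ^ k)" for k
      proof (induction k)
        case (Suc k)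
        have "norm (z (Suc n + Suc k) - z (Suc n))
            \<le> norm (z (Suc (Suc n + k)) - z (Suc n + k)) + norm (z (Suc n + k) - z (Suc n))"
          by (metis add_Suc_right norm_triangle_ineq diff_add_cancel add_diff_eq)
        also have "\<dots> \<le> (1/3) ^ (Suc n + k) + 1/2 * (1/3) ^ n * (1 - (1/3) ^ k)"
          by (intro add_mono z Suc.IH)
        also have "\<dots> = 1/2 * (1/3) ^ n * (1 - (1/3) ^ Suc k)"
          by (simp add: power_add field_simps)
        finally show ?case .
      qed simp
      also have "1/2 * (1/3) ^ n * (1 - (1/3) ^ k) \<le> 1/2 * (1/3::real) ^ n" for k
        by (simp add: field_simps)
      finally have "norm (z (k + Suc n) - z (Suc n)) \<le> 1/2 * (1/3) ^ n" for k
        by (simp add: add.commute)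
      moreover have "(\<lambda>k. norm (z (k + Suc n) - z (Suc n))) \<longlonglongrightarrow> norm (w - z (Suc n))"
        using w by (intro tendsto_intros LIMSEQ_ignore_initial_segment)
      ultimately show ?thesis by (intro LIMSEQ_le_const2) auto
    qed
    have big: "1/6 * (4/3) ^ n \<le> norm (T n w)" for n
    proof -
      have "norm (T n (w - z (Suc n))) \<le> norm (T n) * norm (w - z (Suc n))"
        by (rule norm_blinfun)
      also have "\<dots> \<le> norm (T n) * (1/2 * (1/3) ^ n)" by (intro mult_left_mono tail) simp
      also have "\<dots> = 1/2 * ((1/3) ^ n * norm (T n))" by simp
      finally have "norm (T n (w - z (Suc n))) \<le> 1/2 * ((1/3) ^ n * norm (T n))" .
      moreover have "norm (T n (z (Suc n))) \<le> norm (T n w) + norm (T n (w - z (Suc n)))"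
        by (metis blinfun.diff_right norm_triangle_sub norm_minus_commute)
      ultimately have "1/6 * (1/3) ^ n * norm (T n) \<le> norm (T n w)"
        using z(2)[of n] unfolding mult.assoc by linarith
      moreover have "1/6 * (1/3) ^ n * 4 ^ n \<le> 1/6 * (1/3) ^ n * norm (T n)"
        using T(2)[of n] by (intro mult_left_mono) auto
      ultimately show ?thesis by (simp add: power_divide)
    qed
    obtain C where "\<forall>S\<in>F. norm (S w) \<le> C" using pw by blast
    then have "1/6 * (4/3) ^ n \<le> C" for n using big[of n] T(1)[of n] by (meson order_trans)
    then have "(4/3) ^ n \<le> 6 * C" for n by (simp add: field_simps)
    moreover obtain n where "6 * C < (4/3::real) ^ n" using real_arch_pow[of "4/3" "6 * C"] by auto
    ultimately show False using not_le by blast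
  qed
  then show ?thesis using that by blast
qed

section \<open>The strong dual\<close>

lemma lcs_euclideanreal: "lcs euclideanreal"
proof -
  have "continuous_map euclidean euclidean (\<lambda>(x, y). x + y :: real)"
    by (auto simp: case_prod_beta intro!: continuous_intros)
  moreover have "continuous_map euclidean euclidean (\<lambda>(c, x). c *\<^sub>R x :: real)"
    by (auto simp: case_prod_beta intro!: continuous_intros)
  moreover have "neighbourhood_base_at (0::real) convex euclideanreal"
    unfolding neighbourhood_base_at_def
  proof (intro allI impI)
    fix W :: "real set" assume "openin euclidean W \<and> 0 \<in> W"
    then obtain e where "e > 0" "ball 0 e \<subseteq> W" by (auto simp: open_contains_ball)
    then show "\<exists>U V. openin euclidean U \<and> convex V \<and> 0 \<in> U \<and> U \<subseteq> V \<and> V \<subseteq> W"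
      by (intro exI[of _ "ball 0 e"]) auto
  qed
  ultimately show ?thesis by (simp add: lcs_def)
qed

lemma dual_iff:
  "f \<in> dual E \<longleftrightarrow> continuous_map E euclideanreal f \<and>
     (\<forall>x\<in>topspace E. \<forall>y\<in>topspace E. f (x + y) = f x + f y) \<and>
     (\<forall>c. \<forall>x\<in>topspace E. f (c *\<^sub>R x) = c * f x) \<and> (\<forall>x. x \<notin> topspace E \<longrightarrow> f x = 0)"
  by (simp add: dual_def continuous_linear_ops_def)

lemma subspace_dual: "subspace (dual E)"
  unfolding subspace_def
proof (intro conjI ballI allI)
  show "0 \<in> dual E" using zero_in_dual[of E] by (simp add: zero_fun_def)
  show "f + g \<in> dual E" if "f \<in> dual E" "g \<in> dual E" for f g
    using that by (auto simp: dual_iff plus_fun_def algebra_simps intro!: continuous_map_add)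
  show "c *\<^sub>R f \<in> dual E" if "f \<in> dual E" for c f
    using that
    by (auto simp: dual_iff scaleR_fun_def algebra_simps intro!: continuous_map_real_mult_left)
qed

lemma dual_sum:
  assumes "lcs E" "f \<in> dual E" "\<And>p. p \<in> F \<Longrightarrow> v p \<in> topspace E"
  shows "f (\<Sum>p\<in>F. c p *\<^sub>R v p) = (\<Sum>p\<in>F. c p * f (v p))"
  using assms(3)
proof (induction F rule: infinite_finite_induct)
  case (insert p F)
  have "subspace (topspace E)" using assms(1) by (simp add: lcs_def)
  then have "(\<Sum>p\<in>F. c p *\<^sub>R v p) \<in> topspace E" "c p *\<^sub>R v p \<in> topspace E"
    using insert.prems by (auto intro!: subspace_sum subspace_scale)
  then show ?case using insert assms(2) by (simp add: dual_iff)
qed (use assms(1,2) continuous_linear_ops_zero in \<open>auto simp: dual_def\<close>)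

lemma dual_bounded:
  assumes E: "lcs E" and f: "f \<in> dual E" and B: "vn_bounded E B"
  obtains C where "C > 0" "\<And>x. x \<in> B \<Longrightarrow> \<bar>f x\<bar> \<le> C"
proof -
  have f0: "f 0 = 0" "0 \<in> topspace E"
    using continuous_linear_ops_zero[OF E] f E by (auto simp: dual_def lcs_def subspace_0)
  let ?U = "{x \<in> topspace E. f x \<in> {-1<..<1}}"
  have "openin E ?U"
    using f by (intro openin_continuous_map_preimage[of E euclideanreal]) (auto simp: dual_iff)
  moreover have "0 \<in> ?U" using f0 by simp
  ultimately obtain s where s: "s > 0" "\<forall>t>s. B \<subseteq> (*\<^sub>R) t ` ?U"
    using B unfolding vn_bounded_def by blast
  show ?thesis
  proof
    show "s + 1 > 0" using s(1) by simp
    fix x assume "x \<in> B"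
    then have "x \<in> (*\<^sub>R) (s + 1) ` ?U" using s(2)[rule_format, of "s + 1"] by auto
    then obtain y where "x = (s + 1) *\<^sub>R y" "y \<in> topspace E" "\<bar>f y\<bar> < 1"
      by (auto simp: abs_less_iff)
    then show "\<bar>f x\<bar> \<le> s + 1"
      using f s(1) by (simp add: dual_iff abs_mult mult_left_le)
  qed
qed

lemma vn_bounded_singleton:
  assumes E: "lcs E" and v: "v \<in> topspace E"
  shows "vn_bounded E {v}"
  unfolding vn_bounded_def
proof (intro conjI allI impI)
  show "{v} \<subseteq> topspace E" using v by simp
  fix U assume U: "openin E U \<and> 0 \<in> U"
  have "continuous_map euclideanreal E ((\<lambda>(c, x). c *\<^sub>R x) \<circ> (\<lambda>c. (c, v)))"
    by (rule continuous_map_compose[where X' = "prod_topology euclideanreal E"])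
      (use E v in \<open>auto simp: lcs_def intro!: continuous_map_pairedI\<close>)
  then have "openin euclideanreal {c \<in> topspace euclideanreal. c *\<^sub>R v \<in> U}"
    using U by (intro openin_continuous_map_preimage) (auto simp: o_def)
  then have "open {c. c *\<^sub>R v \<in> U}" "0 \<in> {c. c *\<^sub>R v \<in> U}" using U by auto
  then obtain e where "e > 0" "ball 0 e \<subseteq> {c. c *\<^sub>R v \<in> U}" using open_contains_ball by blast
  then have e: "e > 0" "\<And>c. \<bar>c\<bar> < e \<Longrightarrow> c *\<^sub>R v \<in> U" by (auto simp: subset_eq)
  show "\<exists>s>0. \<forall>t>s. {v} \<subseteq> (*\<^sub>R) t ` U"
  proof (intro exI conjI allI impI)
    show "1 / e > 0" using e by simp
    fix t assume t: "1 / e < t"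
    then have "t > 0" using e by (smt (verit) zero_less_divide_iff)
    with t have "inverse t *\<^sub>R v \<in> U" using e by (intro e) (simp add: field_simps)
    then show "{v} \<subseteq> (*\<^sub>R) t ` U" using \<open>t > 0\<close> by (auto intro!: image_eqI[of _ _ "inverse t *\<^sub>R v"])
  qed
qed

text \<open>The balls of uniform convergence need not be open; shrinking the radius by an unspecified
  amount makes them open.\<close>

lemma strong_dual_ball:
  fixes E :: "'v::real_vector topology"
  assumes B: "vn_bounded E B" and e: "e > 0" and f: "f \<in> dual E"
  defines "U \<equiv> {g \<in> dual E. \<exists>d<e. \<forall>x\<in>B. \<bar>g x - f x\<bar> \<le> d}"
  shows "openin (strong_dual E) U" "f \<in> U"
proof -
  show "f \<in> U" using e f by (auto simp: U_def intro!: exI[of _ 0])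
  show "openin (strong_dual E) U"
    unfolding openin_strong_dual
  proof (intro conjI ballI)
    show "U \<subseteq> dual E" by (auto simp: U_def)
    fix g assume "g \<in> U"
    then obtain d where d: "d < e" "\<And>x. x \<in> B \<Longrightarrow> \<bar>g x - f x\<bar> \<le> d" by (auto simp: U_def)
    have "k \<in> U" if k: "k \<in> dual E" "\<forall>x\<in>B. \<bar>k x - g x\<bar> < (e - d) / 2" for k
    proof -
      have "\<bar>k x - f x\<bar> \<le> (d + e) / 2" if "x \<in> B" for x
        using d(2)[OF that] bspec[OF k(2) that] by argo
      then show ?thesis using k(1) d(1) unfolding U_def by (auto intro!: exI[of _ "(d + e) / 2"])
    qed
    then have "{k \<in> dual E. \<forall>x\<in>B. \<bar>k x - g x\<bar> < (e - d) / 2} \<subseteq> U" by blast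
    then show "\<exists>B e. vn_bounded E B \<and> e > 0 \<and> {k \<in> dual E. \<forall>x\<in>B. \<bar>k x - g x\<bar> < e} \<subseteq> U"
      using B d(1) by (intro exI[of _ B] exI[of _ "(e - d) / 2"]) auto
  qed
qed

lemma openin_strong_dualD:
  assumes "openin (strong_dual E) W" "f \<in> W"
  obtains B e where "vn_bounded E B" "e > 0" "{g \<in> dual E. \<forall>x\<in>B. \<bar>g x - f x\<bar> < e} \<subseteq> W"
proof -
  have "\<exists>B e. vn_bounded E B \<and> e > 0 \<and> {g \<in> dual E. \<forall>x\<in>B. \<bar>g x - f x\<bar> < e} \<subseteq> W"
    using assms unfolding openin_strong_dual by simp
  then show ?thesis using that by (elim exE conjE)
qed

lemma lcs_strong_dual:
  assumes E: "lcs E"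
  shows "lcs (strong_dual E)"
proof -
  let ?D = "strong_dual E"
  define U where "U = (\<lambda>f B e. {g \<in> dual E. \<exists>d<e. \<forall>x\<in>B. \<bar>g x - f x\<bar> \<le> (d::real)})"
  have U: "openin ?D (U f B e)" "f \<in> U f B e" if "vn_bounded E B" "e > 0" "f \<in> dual E" for f B e
    using strong_dual_ball[OF that] by (simp_all add: U_def)
  note sub = subspace_dual[of E]
  have "continuous_map (prod_topology ?D ?D) ?D (\<lambda>(f, g). f + g)"
    unfolding continuous_map_def
  proof (intro conjI allI impI)
    show "(\<lambda>(f, g). f + g) \<in> topspace (prod_topology ?D ?D) \<rightarrow> topspace ?D"
      using sub by (auto simp: subspace_add)
    fix W assume W: "openin ?D W"
    show "openin (prod_topology ?D ?D)
        {p \<in> topspace (prod_topology ?D ?D). (case p of (f, g) \<Rightarrow> f + g) \<in> W}"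
      unfolding openin_prod_topology_alt
    proof (intro allI impI)
      fix f g assume "(f, g) \<in> {p \<in> topspace (prod_topology ?D ?D). (case p of (f, g) \<Rightarrow> f + g) \<in> W}"
      then have fg: "f \<in> dual E" "g \<in> dual E" "f + g \<in> W" by auto
      obtain B e where B: "vn_bounded E B" "e > 0" "{k \<in> dual E. \<forall>x\<in>B. \<bar>k x - (f + g) x\<bar> < e} \<subseteq> W"
        using openin_strong_dualD[OF W fg(3)] .
      have "p + q \<in> W" if "p \<in> U f B (e / 2)" "q \<in> U g B (e / 2)" for p q
      proof -
        have "\<bar>(p + q) x - (f + g) x\<bar> < e" if "x \<in> B" for x
          using \<open>p \<in> U f B (e / 2)\<close> \<open>q \<in> U g B (e / 2)\<close> that unfolding U_def plus_fun_def by fastforce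
        moreover have "p + q \<in> dual E" using that sub by (simp add: U_def subspace_add)
        ultimately show ?thesis using B(3) by blast
      qed
      then have "U f B (e / 2) \<times> U g B (e / 2)
          \<subseteq> {p \<in> topspace (prod_topology ?D ?D). (case p of (f, g) \<Rightarrow> f + g) \<in> W}"
        by (auto simp: U_def)
      then show "\<exists>P Q. openin ?D P \<and> openin ?D Q \<and> f \<in> P \<and> g \<in> Q \<and> P \<times> Q
          \<subseteq> {p \<in> topspace (prod_topology ?D ?D). (case p of (f, g) \<Rightarrow> f + g) \<in> W}"
        using U[OF B(1) _ fg(1)] U[OF B(1) _ fg(2)] B(2)
        by (intro exI[of _ "U f B (e / 2)"] exI[of _ "U g B (e / 2)"]) auto
    qed
  qed
  moreover have "continuous_map (prod_topology euclideanreal ?D) ?D (\<lambda>(c, f). c *\<^sub>R f)"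
    unfolding continuous_map_def
  proof (intro conjI allI impI)
    show "(\<lambda>(c, f). c *\<^sub>R f) \<in> topspace (prod_topology euclideanreal ?D) \<rightarrow> topspace ?D"
      using sub by (auto simp: subspace_scale)
    fix W assume W: "openin ?D W"
    show "openin (prod_topology euclideanreal ?D)
        {p \<in> topspace (prod_topology euclideanreal ?D). (case p of (c, f) \<Rightarrow> c *\<^sub>R f) \<in> W}"
      unfolding openin_prod_topology_alt
    proof (intro allI impI)
      fix c f
      assume "(c, f) \<in> {p \<in> topspace (prod_topology euclideanreal ?D). (case p of (c, f) \<Rightarrow> c *\<^sub>R f) \<in> W}"
      then have f: "f \<in> dual E" "c *\<^sub>R f \<in> W" by auto
      obtain B e where B: "vn_bounded E B" "e > 0" "{k \<in> dual E. \<forall>x\<in>B. \<bar>k x - (c *\<^sub>R f) x\<bar> < e} \<subseteq> W"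
        using openin_strong_dualD[OF W f(2)] .
      obtain C where C: "C > 0" "\<And>x. x \<in> B \<Longrightarrow> \<bar>f x\<bar> \<le> C" using dual_bounded[OF E f(1) B(1)] by blast
      define r where "r = min 1 (e / (2 * C))"
      define s where "s = e / (2 * (\<bar>c\<bar> + 1))"
      have rs: "r > 0" "s > 0" using B(2) C(1) by (auto simp: r_def s_def)
      have "b *\<^sub>R g \<in> W" if b: "b \<in> ball c r" and g: "g \<in> U f B s" for b g
      proof -
        have br: "\<bar>b - c\<bar> < r" using b by (simp add: dist_real_def abs_minus_commute)
        have "\<bar>(b *\<^sub>R g) x - (c *\<^sub>R f) x\<bar> < e" if x: "x \<in> B" for x
        proof -
          have gx: "\<bar>g x - f x\<bar> < s" using g x by (force simp: U_def)
          have "(b *\<^sub>R g) x - (c *\<^sub>R f) x = b * (g x - f x) + (b - c) * f x"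
            by (simp add: scaleR_fun_def algebra_simps)
          also have "\<bar>\<dots>\<bar> \<le> \<bar>b\<bar> * \<bar>g x - f x\<bar> + \<bar>b - c\<bar> * \<bar>f x\<bar>"
            by (metis abs_mult abs_triangle_ineq)
          also have "\<dots> < (\<bar>c\<bar> + 1) * s + r * C"
          proof (rule add_less_le_mono)
            have "\<bar>b\<bar> \<le> \<bar>c\<bar> + 1" using br unfolding r_def by (smt (verit))
            then have "\<bar>b\<bar> * \<bar>g x - f x\<bar> \<le> (\<bar>c\<bar> + 1) * \<bar>g x - f x\<bar>"
              by (intro mult_right_mono) auto
            also have "\<dots> < (\<bar>c\<bar> + 1) * s" using gx by (intro mult_strict_left_mono) auto
            finally show "\<bar>b\<bar> * \<bar>g x - f x\<bar> < (\<bar>c\<bar> + 1) * s" .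
            show "\<bar>b - c\<bar> * \<bar>f x\<bar> \<le> r * C" using br C(2)[OF x] by (intro mult_mono) auto
          qed
          also have "(\<bar>c\<bar> + 1) * s = e / 2"
            by (simp add: s_def field_simps)
          also have "r * C \<le> e / 2" using C(1) by (simp add: r_def min_def field_simps)
          finally show ?thesis by simp
        qed
        moreover have "b *\<^sub>R g \<in> dual E" using g sub by (simp add: U_def subspace_scale)
        ultimately show ?thesis using B(3) by blast
      qed
      moreover have "U f B s \<subseteq> dual E" by (auto simp: U_def)
      ultimately have "ball c r \<times> U f B s
          \<subseteq> {p \<in> topspace (prod_topology euclideanreal ?D). (case p of (c, f) \<Rightarrow> c *\<^sub>R f) \<in> W}"
        by auto
      then show "\<exists>P Q. openin euclideanreal P \<and> openin ?D Q \<and> c \<in> P \<and> f \<in> Q \<and> P \<times> Q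
          \<subseteq> {p \<in> topspace (prod_topology euclideanreal ?D). (case p of (c, f) \<Rightarrow> c *\<^sub>R f) \<in> W}"
        using U[OF B(1) rs(2) f(1)] rs(1) by (intro exI[of _ "ball c r"] exI[of _ "U f B s"]) auto
    qed
  qed
  moreover have "Hausdorff_space ?D"
    unfolding Hausdorff_space_def
  proof (intro allI impI)
    fix f g assume "f \<in> topspace ?D \<and> g \<in> topspace ?D \<and> f \<noteq> g"
    then have fg: "f \<in> dual E" "g \<in> dual E" "f \<noteq> g" by auto
    then obtain v where v: "f v \<noteq> g v" by auto
    then have "v \<in> topspace E" using fg by (auto simp: dual_iff)
    then have B: "vn_bounded E {v}" by (rule vn_bounded_singleton[OF E])
    define e where "e = \<bar>f v - g v\<bar> / 2"
    have "e > 0" using v by (simp add: e_def)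
    moreover have "disjnt (U f {v} e) (U g {v} e)"
      unfolding disjnt_iff U_def e_def by auto
    ultimately show "\<exists>P Q. openin ?D P \<and> openin ?D Q \<and> f \<in> P \<and> g \<in> Q \<and> disjnt P Q"
      using U[OF B _ fg(1), of e] U[OF B _ fg(2), of e]
      by (intro exI[of _ "U f {v} e"] exI[of _ "U g {v} e"]) auto
  qed
  moreover have "neighbourhood_base_at 0 convex ?D"
    unfolding neighbourhood_base_at_def
  proof (intro allI impI)
    fix W assume "openin ?D W \<and> 0 \<in> W"
    then have W: "openin ?D W" "0 \<in> W" by auto
    obtain B e where B: "vn_bounded E B" "e > 0" "{k \<in> dual E. \<forall>x\<in>B. \<bar>k x - 0 x\<bar> < e} \<subseteq> W"
      using openin_strong_dualD[OF W] .
    have "convex {k \<in> dual E. \<forall>x\<in>B. \<bar>k x - 0 x\<bar> < e}"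
    proof (rule convexI)
      fix f g and u v :: real
      assume f: "f \<in> {k \<in> dual E. \<forall>x\<in>B. \<bar>k x - 0 x\<bar> < e}" and g: "g \<in> {k \<in> dual E. \<forall>x\<in>B. \<bar>k x - 0 x\<bar> < e}"
        and uv: "0 \<le> u" "0 \<le> v" "u + v = 1"
      have "\<bar>u * f x + v * g x\<bar> < e" if "x \<in> B" for x
        using convex_bound_lt[of "\<bar>f x\<bar>" e "\<bar>g x\<bar>" u v] f g uv that
        by (auto simp: abs_mult intro!: le_less_trans[OF abs_triangle_ineq])
      then show "u *\<^sub>R f + v *\<^sub>R g \<in> {k \<in> dual E. \<forall>x\<in>B. \<bar>k x - 0 x\<bar> < e}"
        using f g sub by (simp add: subspace_add subspace_scale) (simp add: plus_fun_def scaleR_fun_def)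
    qed
    moreover have "U 0 B e \<subseteq> {k \<in> dual E. \<forall>x\<in>B. \<bar>k x - 0 x\<bar> < e}" by (force simp: U_def)
    ultimately show "\<exists>P V. openin ?D P \<and> convex V \<and> 0 \<in> P \<and> P \<subseteq> V \<and> V \<subseteq> W"
      using U[OF B(1,2) subspace_0[OF sub]] B(3)
      by (intro exI[of _ "U 0 B e"] exI[of _ "{k \<in> dual E. \<forall>x\<in>B. \<bar>k x - 0 x\<bar> < e}"]) (intro conjI)
  qed
  ultimately show ?thesis unfolding lcs_def using sub by simp
qed

text \<open>Extending the evaluation by \<open>0\<close> outside \<open>dual E\<close> is what membership in a dual demands.\<close>

lemma evaluation_in_bidual:
  assumes E: "lcs E" and v: "v \<in> topspace E"
  shows "(\<lambda>f. if f \<in> dual E then f v else 0) \<in> dual (strong_dual E)" (is "?ev \<in> _")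
proof -
  have "continuous_map (strong_dual E) euclideanreal ?ev"
    unfolding continuous_map_def
  proof (intro conjI allI impI)
    fix U :: "real set" assume "openin euclidean U"
    then have U: "open U" by simp
    show "openin (strong_dual E) {f \<in> topspace (strong_dual E). ?ev f \<in> U}"
      unfolding openin_strong_dual
    proof (intro conjI ballI)
      fix f assume "f \<in> {f \<in> topspace (strong_dual E). ?ev f \<in> U}"
      then have f: "f \<in> dual E" "f v \<in> U" by auto
      obtain e where "e > 0" "ball (f v) e \<subseteq> U" using U f(2) open_contains_ball by blast
      then show "\<exists>B e. vn_bounded E B \<and> e > 0 \<and> {g \<in> dual E. \<forall>x\<in>B. \<bar>g x - f x\<bar> < e}
          \<subseteq> {f \<in> topspace (strong_dual E). ?ev f \<in> U}"
        using vn_bounded_singleton[OF E v]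
        by (intro exI[of _ "{v}"] exI[of _ e]) (auto simp: subset_eq dist_real_def abs_minus_commute)
    qed auto
  qed auto
  moreover have "(f + g) \<in> dual E" "c *\<^sub>R f \<in> dual E" if "f \<in> dual E" "g \<in> dual E" for f g c
    using that subspace_dual[of E] by (auto simp: subspace_add subspace_scale)
  ultimately show ?thesis
    unfolding dual_iff[of _ "strong_dual E"] by (simp add: plus_fun_def scaleR_fun_def)
qed

text \<open>Continuity at \<open>0\<close>: a functional on the strong dual is controlled by the values on one bounded
  set.\<close>

lemma bidual_bound:
  assumes E: "lcs E" and \<phi>: "\<phi> \<in> dual (strong_dual E)"
  obtains B e where "vn_bounded E B" "e > 0"
    "\<And>g. g \<in> dual E \<Longrightarrow> (\<And>x. x \<in> B \<Longrightarrow> \<bar>g x\<bar> < e) \<Longrightarrow> \<bar>\<phi> g\<bar> < 1"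
proof -
  let ?W = "{g \<in> topspace (strong_dual E). \<phi> g \<in> {-1<..<1}}"
  have "openin (strong_dual E) ?W"
    using \<phi> by (intro openin_continuous_map_preimage[of _ euclideanreal]) (auto simp: dual_iff)
  moreover have "\<phi> 0 = 0"
    using continuous_linear_ops_zero[OF lcs_strong_dual[OF E]] \<phi> unfolding dual_def[of "strong_dual E"] by blast
  then have "0 \<in> ?W" using subspace_0[OF subspace_dual[of E]] by simp
  ultimately obtain B e where "vn_bounded E B" "e > 0" "{g \<in> dual E. \<forall>x\<in>B. \<bar>g x - 0 x\<bar> < e} \<subseteq> ?W"
    by (rule openin_strong_dualD)
  then show ?thesis by (intro that[of B e]) (auto simp: subset_eq)
qed

section \<open>Free locally convex spaces\<close>

text \<open>The universal property retracts \<open>L\<close> onto the span of the image of \<open>X\<close>; as a map into \<open>L\<close> this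
  retraction and the identity both extend \<open>i\<close>, so they coincide.\<close>

lemma free_lcs_span:
  fixes L :: "'v::real_vector topology"
  assumes "free_lcs X L i"
  shows "topspace L = span (i ` topspace X)"
proof -
  let ?S = "span (i ` topspace X)"
  let ?P = "pullback_topology ?S id L"
  have L: "lcs L" and i: "continuous_map X L i" using assms by (auto simp: free_lcs_def)
  have SL: "?S \<subseteq> topspace L"
    using L i by (intro span_minimal) (auto simp: lcs_def continuous_map_def)
  have P: "lcs ?P" using SL by (intro lcs_pullback[OF L]) auto
  have tP: "topspace ?P = ?S" using SL by (auto simp: topspace_pullback_topology)
  have "continuous_map X ?P i"
    using i by (intro continuous_map_pullback') (auto simp: o_def id_def intro: span_base)
  then obtain T where T: "T \<in> continuous_linear_ops L ?P" "\<forall>x\<in>topspace X. T (i x) = i x"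
    using free_lcs_universal[OF assms P] by blast
  have "continuous_map ?P L id" using continuous_map_pullback[OF continuous_map_id, of ?S id L] by simp
  then have "continuous_map L L (id \<circ> T)"
    using T(1) by (intro continuous_map_compose) (auto simp: continuous_linear_ops_def)
  then have TL: "T \<in> continuous_linear_ops L L" using T(1) by (simp add: continuous_linear_ops_def)
  define J where "J = (\<lambda>v. if v \<in> topspace L then v else 0)"
  have "continuous_map L L J"
    by (rule continuous_map_eq[OF continuous_map_id]) (simp add: J_def)
  then have "J \<in> continuous_linear_ops L L"
    using L unfolding continuous_linear_ops_def lcs_def
    by (auto simp: J_def subspace_add subspace_scale)
  moreover have "J (i x) = i x" if "x \<in> topspace X" for x
    using i that by (auto simp: J_def continuous_map_def)
  ultimately have "T = J" using free_lcs_universal[OF assms L i] T(2) TL by blast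
  have "v \<in> ?S" if "v \<in> topspace L" for v
  proof -
    have "T v \<in> topspace ?P" using T(1) that by (auto simp: continuous_linear_ops_def continuous_map_def)
    then show ?thesis using that by (simp add: \<open>T = J\<close> J_def tP)
  qed
  then show ?thesis using SL by blast
qed

lemma free_lcs_expansion:
  assumes fL: "free_lcs X L i" and v: "v \<in> topspace L"
  obtains F c where "finite F" "F \<subseteq> topspace X" "\<And>f. f \<in> dual L \<Longrightarrow> f v = (\<Sum>p\<in>F. c p * f (i p))"
proof -
  have L: "lcs L" and i: "continuous_map X L i" using fL by (auto simp: free_lcs_def)
  obtain t r where t: "finite t" "t \<subseteq> i ` topspace X" "v = (\<Sum>a\<in>t. r a *\<^sub>R a)"
    using v unfolding free_lcs_span[OF fL] span_explicit by auto
  obtain F where F: "F \<subseteq> topspace X" "inj_on i F" "t = i ` F" using t(2) by (meson subset_image_inj)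
  have v_eq: "v = (\<Sum>p\<in>F. r (i p) *\<^sub>R i p)" using t(3) F(2,3) by (simp add: sum.reindex)
  show ?thesis
  proof (rule that[of F "\<lambda>p. r (i p)"])
    show "finite F" using t(1) F by (simp add: finite_image_iff)
    show "f v = (\<Sum>p\<in>F. r (i p) * f (i p))" if "f \<in> dual L" for f
      unfolding v_eq using F(1) i by (intro dual_sum[OF L that]) (auto simp: continuous_map_def)
  qed (rule F(1))
qed

definition free_extension :: "'a topology \<Rightarrow> 'v::real_vector topology \<Rightarrow> ('a \<Rightarrow> 'v) \<Rightarrow> ('a \<Rightarrow> real) \<Rightarrow> 'v \<Rightarrow> real"
  where "free_extension X L i f = (THE T. T \<in> dual L \<and> (\<forall>x\<in>topspace X. T (i x) = f x))"

lemma free_extension: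
  assumes "free_lcs X L i" "continuous_map X euclideanreal f"
  shows "free_extension X L i f \<in> dual L"
    and "x \<in> topspace X \<Longrightarrow> free_extension X L i f (i x) = f x"
proof -
  have "\<exists>!T. T \<in> dual L \<and> (\<forall>x\<in>topspace X. T (i x) = f x)"
    unfolding dual_def by (rule free_lcs_universal[OF assms(1) lcs_euclideanreal assms(2)])
  from theI'[OF this]
  show "free_extension X L i f \<in> dual L"
    and "x \<in> topspace X \<Longrightarrow> free_extension X L i f (i x) = f x"
    by (simp_all add: free_extension_def)
qed

lemma free_extension_unique:
  assumes "free_lcs X L i" "continuous_map X euclideanreal f"
    and "T \<in> dual L" "\<And>x. x \<in> topspace X \<Longrightarrow> T (i x) = f x"
  shows "free_extension X L i f = T"
  by (rule ex1E[OF free_lcs_universal[OF assms(1) lcs_euclideanreal assms(2)]])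
    (metis assms(3,4) free_extension[OF assms(1,2)] dual_def)

section \<open>Discrete spaces\<close>

lemma lower_triangular_system_solvable:
  fixes a :: "nat \<Rightarrow> nat \<Rightarrow> 'a::field"
  assumes "\<And>k. a k k \<noteq> 0"
  obtains c where "\<And>k. (\<Sum>j\<le>k. a k j * c j) = b k"
proof -
  have "\<exists>c. \<forall>k. a k k * c k + (\<Sum>j<k. a k j * c j) = b k"
  proof (rule dependent_wellorder_choice)
    show "(a x x * r + (\<Sum>j<x. a x j * f j) = b x) = (a x x * r + (\<Sum>j<x. a x j * g j) = b x)"
      if "\<And>y. y < x \<Longrightarrow> f y = g y" for r f g x
      using that by simp
    show "\<exists>r. a k k * r + (\<Sum>j<k. a k j * c j) = b k" for k c
      using assms[of k] by (intro exI[of _ "(b k - (\<Sum>j<k. a k j * c j)) / a k k"]) simp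
  qed
  then show ?thesis
    using that by (simp add: lessThan_Suc_atMost[symmetric] add.commute) metis
qed

text \<open>The functionals induced by the indicators of single points are coordinates on \<open>L\<close>.  The finite
  set \<open>A\<close> may exceed the support, so that several vectors can be expanded over the same points.\<close>

lemma free_lcs_discrete_expansion:
  assumes fL: "free_lcs X L i" and X: "X = discrete_topology (topspace X)" and v: "v \<in> topspace L"
  defines "b \<equiv> \<lambda>p. free_extension X L i (indicator {p})"
  shows "finite {p \<in> topspace X. b p v \<noteq> 0}"
    and "\<lbrakk>finite A; {p \<in> topspace X. b p v \<noteq> 0} \<subseteq> A; A \<subseteq> topspace X; f \<in> dual L\<rbrakk>
      \<Longrightarrow> f v = (\<Sum>p\<in>A. b p v * f (i p))"
proof -
  have cont: "continuous_map X euclideanreal f" for f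
    by (subst X) simp
  have b: "b p \<in> dual L" "q \<in> topspace X \<Longrightarrow> b p (i q) = indicator {p} q" for p q
    using free_extension[OF fL cont] by (simp_all add: b_def)
  obtain F c where F: "finite F" "F \<subseteq> topspace X"
    "\<And>f. f \<in> dual L \<Longrightarrow> f v = (\<Sum>p\<in>F. c p * f (i p))"
    using free_lcs_expansion[OF fL v] by metis
  have c: "b q v = (if q \<in> F then c q else 0)" for q
  proof -
    have "b q v = (\<Sum>p\<in>F. c p * b q (i p))" using F(3) b(1) by blast
    also have "\<dots> = (\<Sum>p\<in>F. if p = q then c p else 0)"
      using F(2) b(2) by (intro sum.cong) (auto simp: indicator_def)
    finally show ?thesis using F(1) by simp
  qed
  have S: "{p \<in> topspace X. b p v \<noteq> 0} \<subseteq> F" by (auto simp: c)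
  then show "finite {p \<in> topspace X. b p v \<noteq> 0}" using F(1) finite_subset by blast
  assume A: "finite A" "{p \<in> topspace X. b p v \<noteq> 0} \<subseteq> A" "A \<subseteq> topspace X" and f: "f \<in> dual L"
  have "f v = (\<Sum>p\<in>F. b p v * f (i p))" using F(3)[OF f] by (simp add: c)
  also have "\<dots> = (\<Sum>p\<in>A \<inter> F. b p v * f (i p))"
    using F(1,2) A(2) by (intro sum.mono_neutral_right) auto
  also have "\<dots> = (\<Sum>p\<in>A. b p v * f (i p))"
    using A(1) by (intro sum.mono_neutral_left) (auto simp: c)
  finally show "f v = (\<Sum>p\<in>A. b p v * f (i p))" .
qed

text \<open>Otherwise there are terms \<open>x (n k)\<close> of the sequence, each with a point \<open>p k\<close> in its support that
  none of \<open>x (n 0), \<dots>, x (n (k - 1))\<close> has.  Since every function on \<open>X\<close> is continuous, its values at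
  the points \<open>p k\<close> can be prescribed one after the other such that the induced functional is \<open>1\<close> at
  all \<open>x (n k)\<close>, which contradicts weak convergence to \<open>0\<close>.\<close>

lemma discrete_weakly_null_support_finite:
  assumes fL: "free_lcs X L i" and X: "X = discrete_topology (topspace X)"
    and null: "weakly_null L x"
  shows "finite {p \<in> topspace X. \<exists>n. free_extension X L i (indicator {p}) (x n) \<noteq> 0}" (is "finite ?A")
proof (rule ccontr)
  let ?b = "\<lambda>p. free_extension X L i (indicator {p})"
  assume inf: "infinite ?A"
  have L: "lcs L" using fL by (simp add: free_lcs_def)
  have xL: "\<And>n. x n \<in> topspace L" and lim: "\<And>f. f \<in> dual L \<Longrightarrow> (\<lambda>n. f (x n)) \<longlonglongrightarrow> 0"
    using null weakly_null_iff[OF L] by auto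
  have cont: "continuous_map X euclideanreal f" for f
    by (subst X) simp
  note ext = free_extension[OF fL cont]
  define S where "S n = {p \<in> topspace X. ?b p (x n) \<noteq> 0}" for n
  have expand: "finite (S n)" "f \<in> dual L \<Longrightarrow> f (x n) = (\<Sum>p\<in>S n. ?b p (x n) * f (i p))" for n f
    using free_lcs_discrete_expansion[OF fL X xL] by (simp_all add: S_def)
  have A: "?A = (\<Union>n. S n)" by (auto simp: S_def)
  (* Here s k is the pair of an index n and a new point p of the support of x n; the condition
     k \<le> n makes the chosen indices tend to infinity. *)
  have "\<exists>s. \<forall>k. case s k of (n, p) \<Rightarrow> k \<le> n \<and> p \<in> S n \<and> (\<forall>j<k. p \<notin> S (fst (s j)))"
  proof (rule dependent_wellorder_choice)
    show "(case r of (n, p) \<Rightarrow> k \<le> n \<and> p \<in> S n \<and> (\<forall>j<k. p \<notin> S (fst (s j))))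
        = (case r of (n, p) \<Rightarrow> k \<le> n \<and> p \<in> S n \<and> (\<forall>j<k. p \<notin> S (fst (t j))))"
      if "\<And>j. j < k \<Longrightarrow> s j = t j" for r s t k
      using that by auto
    show "\<exists>r. case r of (n, p) \<Rightarrow> k \<le> n \<and> p \<in> S n \<and> (\<forall>j<k. p \<notin> S (fst (s j)))"
      for k and s :: "nat \<Rightarrow> nat \<times> 'a"
    proof -
      have "finite ((\<Union>n<k. S n) \<union> (\<Union>j<k. S (fst (s j))))" using expand(1) by auto
      then obtain p where p: "p \<in> ?A" "p \<notin> (\<Union>n<k. S n) \<union> (\<Union>j<k. S (fst (s j)))"
        using inf by (meson finite_subset subsetI)
      then obtain n where "p \<in> S n" using A by blast
      then have "k \<le> n" using p(2) by (meson UN_I UnI1 lessThan_iff not_le)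
      then show ?thesis using \<open>p \<in> S n\<close> p(2) by (intro exI[of _ "(n, p)"]) auto
    qed
  qed
  then obtain s where s: "\<And>k. case s k of (n, p) \<Rightarrow> k \<le> n \<and> p \<in> S n \<and> (\<forall>j<k. p \<notin> S (fst (s j)))"
    by blast
  define n where "n k = fst (s k)" for k
  define p where "p k = snd (s k)" for k
  have np: "k \<le> n k" "p k \<in> S (n k)" "j < k \<Longrightarrow> p k \<notin> S (n j)" for j k
    using s[of k] by (auto simp: n_def p_def split: prod.splits)
  have inj: "inj p"
    by (rule linorder_injI) (metis np(2,3))
  obtain c where c: "\<And>k. (\<Sum>j\<le>k. ?b (p j) (x (n k)) * c j) = 1"
    using lower_triangular_system_solvable[of "\<lambda>k j. ?b (p j) (x (n k))" "\<lambda>_. 1"] np(2)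
    unfolding S_def by auto
  define f where "f q = (if q \<in> range p then c (inv p q) else 0)" for q
  have fp: "f (p j) = c j" for j using inj by (simp add: f_def)
  let ?f = "free_extension X L i f"
  have one: "?f (x (n k)) = 1" for k
  proof -
    have "?f (x (n k)) = (\<Sum>q\<in>S (n k). ?b q (x (n k)) * ?f (i q))" using expand(2) ext(1) .
    also have "\<dots> = (\<Sum>q\<in>S (n k). ?b q (x (n k)) * f q)"
      using ext(2) by (intro sum.cong) (auto simp: S_def)
    also have "\<dots> = (\<Sum>q\<in>S (n k) \<inter> p ` {..k}. ?b q (x (n k)) * f q)"
    proof (rule sum.mono_neutral_right)
      show "\<forall>q\<in>S (n k) - S (n k) \<inter> p ` {..k}. ?b q (x (n k)) * f q = 0"
      proof
        fix q assume q: "q \<in> S (n k) - S (n k) \<inter> p ` {..k}"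
        have "q \<noteq> p j" for j using q np(3)[of k j] by (cases "j \<le> k") auto
        then show "?b q (x (n k)) * f q = 0" by (auto simp: f_def)
      qed
    qed (use expand(1) in auto)
    also have "\<dots> = (\<Sum>q\<in>p ` {..k}. ?b q (x (n k)) * f q)"
      using np(2) by (intro sum.mono_neutral_left) (auto simp: S_def)
    also have "\<dots> = (\<Sum>j\<le>k. ?b (p j) (x (n k)) * c j)"
      using inj by (simp add: sum.reindex inj_on_subset fp)
    finally show ?thesis using c by simp
  qed
  have "filterlim n at_top sequentially"
    using np(1) by (intro filterlim_at_top_mono[OF filterlim_ident]) auto
  then have "(\<lambda>k. ?f (x (n k))) \<longlonglongrightarrow> 0"
    using filterlim_compose[OF lim[OF ext(1)]] by blast
  then show False using LIMSEQ_unique tendsto_const[of 1] unfolding one by fastforce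
qed

theorem discrete_imp_sequential_Dunford_Pettis:
  assumes fL: "free_lcs X L i" and X: "X = discrete_topology (topspace X)"
  shows "sequential_Dunford_Pettis L"
  unfolding sequential_Dunford_Pettis_def
proof (intro allI impI)
  fix x \<phi> assume "weakly_null L x \<and> weakly_null (strong_dual L) \<phi>"
  then have null: "weakly_null L x" and null': "weakly_null (strong_dual L) \<phi>" by auto
  have L: "lcs L" and i: "continuous_map X L i" using fL by (auto simp: free_lcs_def)
  have xL: "\<And>n. x n \<in> topspace L" and lim: "\<And>f. f \<in> dual L \<Longrightarrow> (\<lambda>n. f (x n)) \<longlonglongrightarrow> 0"
    using null weakly_null_iff[OF L] by auto
  have \<phi>L: "\<And>n. \<phi> n \<in> dual L"
    and lim': "\<And>\<psi>. \<psi> \<in> dual (strong_dual L) \<Longrightarrow> (\<lambda>n. \<psi> (\<phi> n)) \<longlonglongrightarrow> 0"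
    using null' weakly_null_iff[OF lcs_strong_dual[OF L]] by auto
  have cont: "continuous_map X euclideanreal f" for f
    by (subst X) simp
  let ?b = "\<lambda>p. free_extension X L i (indicator {p})"
  let ?A = "{p \<in> topspace X. \<exists>n. ?b p (x n) \<noteq> 0}"
  have A: "finite ?A" using discrete_weakly_null_support_finite[OF fL X null] .
  have "f (x n) = (\<Sum>p\<in>?A. ?b p (x n) * f (i p))" if f: "f \<in> dual L" for f n
    by (rule free_lcs_discrete_expansion(2)[OF fL X xL A _ _ f]) auto
  then have "\<phi> n (x n) = (\<Sum>p\<in>?A. ?b p (x n) * \<phi> n (i p))" for n using \<phi>L by blast
  moreover have "(\<lambda>n. \<Sum>p\<in>?A. ?b p (x n) * \<phi> n (i p)) \<longlonglongrightarrow> (\<Sum>p\<in>?A. 0 * 0)"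
  proof (intro tendsto_sum tendsto_mult)
    fix p assume "p \<in> ?A"
    then have ip: "i p \<in> topspace L" using i by (auto simp: continuous_map_def)
    show "(\<lambda>n. ?b p (x n)) \<longlonglongrightarrow> 0" using lim free_extension(1)[OF fL cont] by blast
    show "(\<lambda>n. \<phi> n (i p)) \<longlonglongrightarrow> 0"
      using lim'[OF evaluation_in_bidual[OF L ip]] \<phi>L by simp
  qed
  ultimately show "(\<lambda>n. \<phi> n (x n)) \<longlonglongrightarrow> 0" by simp
qed

section \<open>Spaces with a nontrivial convergent sequence\<close>

instance bcontfun :: (metric_space, banach) banach ..

lemma sum_apply_bcontfun:
  fixes g :: "'i \<Rightarrow> 'b::topological_space \<Rightarrow>\<^sub>C 'c::real_normed_vector"
  shows "apply_bcontfun (sum g F) x = (\<Sum>k\<in>F. apply_bcontfun (g k) x)"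
  by (induction F rule: infinite_finite_induct) auto

text \<open>A bounded set \<open>B\<close> of \<open>L\<close> acts on bounded continuous functions \<open>g\<close> by
  \<open>v \<mapsto> (g \<mapsto> free_extension X L i (g \<circ> h) v)\<close>.  Every vector \<open>v\<close> is a finite combination of points, so
  that each of these functionals is bounded, and they are pointwise bounded because functionals on \<open>L\<close>
  are bounded on \<open>B\<close>.  Uniform boundedness then turns strong continuity into norm continuity.\<close>

lemma bidual_comp_bounded_linear:
  fixes h :: "'a \<Rightarrow> 'b::metric_space"
  assumes fL: "free_lcs X L i" and h: "continuous_map X euclidean h"
    and \<phi>: "\<phi> \<in> dual (strong_dual L)"
  shows "bounded_linear (\<lambda>g :: 'b \<Rightarrow>\<^sub>C real. \<phi> (free_extension X L i (apply_bcontfun g \<circ> h)))"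
proof -
  let ?J = "\<lambda>g :: 'b \<Rightarrow>\<^sub>C real. free_extension X L i (apply_bcontfun g \<circ> h)"
  have L: "lcs L" using fL by (simp add: free_lcs_def)
  have cont: "continuous_map X euclideanreal (apply_bcontfun g \<circ> h)" for g :: "'b \<Rightarrow>\<^sub>C real"
    by (rule continuous_map_compose[OF h]) simp
  note J = free_extension[OF fL cont]
  have J_add: "?J (f + g) = ?J f + ?J g" and J_scale: "?J (c *\<^sub>R f) = c *\<^sub>R ?J f" for f g c
  proof -
    have "?J f + ?J g \<in> dual L" using J(1) subspace_dual subspace_add by blast
    then show "?J (f + g) = ?J f + ?J g"
      by (rule free_extension_unique[OF fL cont]) (simp add: plus_fun_def J(2))
    have "c *\<^sub>R ?J f \<in> dual L" using J(1) subspace_dual subspace_scale by blast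
    then show "?J (c *\<^sub>R f) = c *\<^sub>R ?J f"
      by (rule free_extension_unique[OF fL cont]) (simp add: scaleR_fun_def J(2))
  qed
  have bl: "bounded_linear (\<lambda>g. ?J g v)" if v: "v \<in> topspace L" for v
  proof -
    obtain F c where F: "finite F" "F \<subseteq> topspace X"
      "\<And>f. f \<in> dual L \<Longrightarrow> f v = (\<Sum>p\<in>F. c p * f (i p))"
      using free_lcs_expansion[OF fL v] by metis
    have eq: "?J g v = (\<Sum>p\<in>F. c p * g (h p))" for g
      unfolding F(3)[OF J(1)] using F(2) J(2) by (intro sum.cong) auto
    have "bounded_linear (\<lambda>g :: 'b \<Rightarrow>\<^sub>C real. g y)" for y
      using norm_bounded[of "_ :: 'b \<Rightarrow>\<^sub>C real" y]
      by (intro bounded_linear_intro[where K = 1]) auto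
    then show ?thesis
      unfolding eq by (intro bounded_linear_sum bounded_linear_mult_const bounded_linear_const_mult)
  qed
  obtain B e where B: "vn_bounded L B" "e > 0"
    "\<And>g. g \<in> dual L \<Longrightarrow> (\<And>x. x \<in> B \<Longrightarrow> \<bar>g x\<bar> < e) \<Longrightarrow> \<bar>\<phi> g\<bar> < 1"
    using bidual_bound[OF L \<phi>] by metis
  have BL: "B \<subseteq> topspace L" using B(1) by (simp add: vn_bounded_def)
  have "\<exists>M. \<forall>v\<in>B. norm (Blinfun (\<lambda>g. ?J g v)) \<le> M"
  proof -
    have "\<exists>C. \<forall>T\<in>(\<lambda>v. Blinfun (\<lambda>g. ?J g v)) ` B. norm (blinfun_apply T g) \<le> C"
      for g :: "'b \<Rightarrow>\<^sub>C real"
    proof -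
      obtain C where "\<And>v. v \<in> B \<Longrightarrow> \<bar>?J g v\<bar> \<le> C" using dual_bounded[OF L J(1) B(1)] by metis
      then show ?thesis using bl BL by (auto simp: bounded_linear_Blinfun_apply subset_eq)
    qed
    then obtain M where "\<And>T. T \<in> (\<lambda>v. Blinfun (\<lambda>g. ?J g v)) ` B \<Longrightarrow> norm T \<le> M"
      using uniform_boundedness[of "(\<lambda>v. Blinfun (\<lambda>g. ?J g v)) ` B"] by blast
    then show ?thesis by blast
  qed
  then obtain M where M: "\<And>v. v \<in> B \<Longrightarrow> norm (Blinfun (\<lambda>g. ?J g v)) \<le> M" by blast
  (* M may be negative when B is empty. *)
  define M' where "M' = max M 1"
  have JM: "\<bar>?J g v\<bar> \<le> M' * norm g" if v: "v \<in> B" for g v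
  proof -
    have "\<bar>?J g v\<bar> = norm (blinfun_apply (Blinfun (\<lambda>g. ?J g v)) g)"
      using bl v BL by (auto simp: bounded_linear_Blinfun_apply)
    also have "\<dots> \<le> norm (Blinfun (\<lambda>g. ?J g v)) * norm g" by (rule norm_blinfun)
    also have "\<dots> \<le> M' * norm g" using M[OF v] by (intro mult_right_mono) (auto simp: M'_def)
    finally show ?thesis .
  qed
  define r where "r = e / (2 * M')"
  have "M' > 0" by (simp add: M'_def)
  then have r: "r > 0" "M' * r < e" using B(2) by (auto simp: r_def)
  have \<phi>_lin: "\<phi> (f + g) = \<phi> f + \<phi> g" "\<phi> (c *\<^sub>R f) = c * \<phi> f" if "f \<in> dual L" "g \<in> dual L" for f g c
    using \<phi> that by (auto simp: dual_iff[of \<phi>])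
  have scale: "\<phi> (?J (c *\<^sub>R g)) = c * \<phi> (?J g)" for c g unfolding J_scale by (rule \<phi>_lin(2)[OF J(1) J(1)])
  show ?thesis
  proof (rule bounded_linear_intro[where K = "1 / r"])
    show "\<phi> (?J (f + g)) = \<phi> (?J f) + \<phi> (?J g)" for f g unfolding J_add by (rule \<phi>_lin(1)[OF J(1) J(1)])
    show "\<phi> (?J (c *\<^sub>R g)) = c *\<^sub>R \<phi> (?J g)" for c g by (simp only: scale real_scaleR_def)
    have small: "\<bar>\<phi> (?J g)\<bar> < 1" if g: "norm g \<le> r" for g
    proof (rule B(3)[OF J(1)])
      fix v assume "v \<in> B"
      then have "\<bar>?J g v\<bar> \<le> M' * norm g" by (rule JM)
      also have "\<dots> \<le> M' * r" using g \<open>M' > 0\<close> by (intro mult_left_mono) auto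
      finally show "\<bar>?J g v\<bar> < e" using r(2) by simp
    qed
    show "norm (\<phi> (?J g)) \<le> norm g * (1 / r)" for g
    proof (cases "g = 0")
      case True
      then show ?thesis using scale[of 0 0] by simp
    next
      case False
      then have "\<bar>\<phi> (?J ((r / norm g) *\<^sub>R g))\<bar> < 1" using r(1) by (intro small) simp
      then show ?thesis unfolding scale using False r(1) by (simp add: abs_mult field_simps)
    qed
  qed
qed

text \<open>Choosing the signs \<open>\<epsilon> k = sgn (\<psi> (g k))\<close> shows that \<open>\<Sum>k. \<bar>\<psi> (g k)\<bar>\<close> converges.\<close>

lemma bounded_linear_tendsto_zero_of_bounded_signed_sums:
  fixes \<psi> :: "'a::real_normed_vector \<Rightarrow> real" and g :: "nat \<Rightarrow> 'a"
  assumes \<psi>: "bounded_linear \<psi>"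
    and C: "\<And>\<epsilon> N. (\<And>k. \<bar>\<epsilon> k\<bar> \<le> 1) \<Longrightarrow> norm (\<Sum>k<N. \<epsilon> k *\<^sub>R g k) \<le> C"
  shows "(\<lambda>k. \<psi> (g k)) \<longlonglongrightarrow> 0"
proof -
  interpret bounded_linear \<psi> by (rule \<psi>)
  obtain K where K: "K \<ge> 0" "\<And>x. norm (\<psi> x) \<le> norm x * K" using nonneg_bounded by auto
  have "(\<Sum>k<N. \<bar>\<psi> (g k)\<bar>) \<le> C * K" for N
  proof -
    have sgn: "sgn y * y = \<bar>y\<bar>" for y :: real by (simp add: sgn_if)
    have "(\<Sum>k<N. \<bar>\<psi> (g k)\<bar>) = \<psi> (\<Sum>k<N. sgn (\<psi> (g k)) *\<^sub>R g k)"
      by (simp add: sum scale sgn)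
    also have "\<dots> \<le> norm (\<Sum>k<N. sgn (\<psi> (g k)) *\<^sub>R g k) * K"
      by (rule abs_le_D1[OF K(2)[unfolded real_norm_def]])
    also have "\<dots> \<le> C * K" using K(1) by (intro mult_right_mono C) (auto simp: sgn_if)
    finally show ?thesis .
  qed
  then have "summable (\<lambda>k. \<bar>\<psi> (g k)\<bar>)" by (intro summableI_nonneg_bounded) auto
  from summable_LIMSEQ_zero[OF this] show ?thesis by (simp only: tendsto_rabs_zero_iff)
qed

text \<open>The tent at \<open>t k\<close> vanishes outside the interval from \<open>t k / 2\<close> to \<open>3 * t k / 2\<close>, and the factor
  \<open>3\<close> makes these intervals disjoint.\<close>

lemma disjoint_tents:
  fixes t :: "nat \<Rightarrow> real"
  assumes pos: "\<And>k. t k > 0" and dec: "\<And>k. 3 * t (Suc k) \<le> t k"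
  obtains g :: "nat \<Rightarrow> real \<Rightarrow>\<^sub>C real" where "\<And>k. g k (t k) = 1" "\<And>k. g k 0 = 0"
    "\<And>\<epsilon> N. (\<And>k. \<bar>\<epsilon> k\<bar> \<le> 1) \<Longrightarrow> norm (\<Sum>k<N. \<epsilon> k *\<^sub>R g k) \<le> 1"
proof -
  define f where "f k u = max 0 (1 - 2 * \<bar>u / t k - 1\<bar>)" for k u
  define g where "g k = Bcontfun (f k)" for k
  have f: "0 \<le> f k u" "f k u \<le> 1" for k u by (auto simp: f_def)
  have "f k \<in> bcontfun" for k
    using f pos[of k] by (intro bcontfun_normI[where b = 1])
      (auto simp: f_def[abs_def] intro!: continuous_intros)
  then have g: "apply_bcontfun (g k) = f k" for k by (simp add: g_def Bcontfun_inverse)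
  have gap: "3 * t j \<le> t k" if "k < j" for j k
    using that
  proof (induction j)
    case (Suc j)
    show ?case
    proof (cases "k = j")
      case False
      then have "3 * t j \<le> t k" using Suc by simp
      then show ?thesis using dec[of j] pos[of j] by linarith
    qed (use dec in auto)
  qed simp
  have supp: "t k / 2 < u" "u < 3 * t k / 2" if "f k u \<noteq> 0" for k u
  proof -
    have "\<bar>u / t k - 1\<bar> < 1 / 2" using that by (auto simp: f_def max_def split: if_splits)
    then have "1 / 2 < u / t k" "u / t k < 3 / 2" unfolding abs_less_iff by linarith+
    then show "t k / 2 < u" "u < 3 * t k / 2" using pos[of k] by (simp_all add: field_simps)
  qed
  have disj: "j = k" if "f j u \<noteq> 0" "f k u \<noteq> 0" for j k u
  proof (rule ccontr)
    assume "j \<noteq> k"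
    then have "3 * t j \<le> t k \<or> 3 * t k \<le> t j" using gap by (meson linorder_neqE_nat)
    then show False using supp[OF that(1)] supp[OF that(2)] by linarith
  qed
  show ?thesis
  proof (rule that[of g])
    show "g k (t k) = 1" for k using pos[of k] by (simp add: g f_def)
    show "g k 0 = 0" for k by (simp add: g f_def)
    fix \<epsilon> :: "nat \<Rightarrow> real" and N assume \<epsilon>: "\<And>k. \<bar>\<epsilon> k\<bar> \<le> 1"
    show "norm (\<Sum>k<N. \<epsilon> k *\<^sub>R g k) \<le> 1"
    proof (rule norm_bound)
      fix u
      have eq: "(\<Sum>k<N. \<epsilon> k *\<^sub>R g k) u = (\<Sum>k<N. \<epsilon> k * f k u)" by (simp add: sum_apply_bcontfun g)
      show "norm ((\<Sum>k<N. \<epsilon> k *\<^sub>R g k) u) \<le> 1"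
      proof (cases "\<exists>j<N. f j u \<noteq> 0")
        case True
        then obtain j where j: "j < N" "f j u \<noteq> 0" by blast
        then have "(\<Sum>k<N. \<epsilon> k * f k u) = (\<Sum>k\<in>{j}. \<epsilon> k * f k u)"
          using disj by (intro sum.mono_neutral_right) auto
        then show ?thesis using \<epsilon>[of j] f[of j u] by (simp add: eq abs_mult mult_le_one)
      qed (simp add: eq)
    qed
  qed
qed

text \<open>The sum of \<open>(1/2) ^ n * f n\<close>, where \<open>f n\<close> separates \<open>a\<close> from \<open>s n\<close>.\<close>

lemma continuous_function_separating_sequence:
  fixes s :: "nat \<Rightarrow> 'a"
  assumes X: "tychonoff_space X" and a: "a \<in> topspace X" and s: "range s \<subseteq> topspace X - {a}"
  obtains h where "continuous_map X euclideanreal h" "h a = 0" "\<And>n. h (s n) > 0"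
proof -
  have "\<exists>f. continuous_map X (top_of_set {0..1::real}) f \<and> f a = 0 \<and> f (s n) = 1" for n
  proof -
    have "closedin X {s n}"
      using X s unfolding tychonoff_space_def
      by (intro closedin_Hausdorff_singleton) auto
    moreover have "a \<in> topspace X - {s n}" using a s by auto
    moreover have "completely_regular_space X" using X by (simp add: tychonoff_space_def)
    ultimately have "\<exists>f. continuous_map X (top_of_set {0..1::real}) f \<and> f a = 0 \<and> f ` {s n} \<subseteq> {1}"
      unfolding completely_regular_space_def by blast
    then show ?thesis by simp
  qed
  then obtain f where f: "\<And>n. continuous_map X (top_of_set {0..1::real}) (f n)"
    "\<And>n. f n a = 0" "\<And>n. f n (s n) = 1" by metis
  have fc: "continuous_map X euclideanreal (f n)" and f01: "x \<in> topspace X \<Longrightarrow> f n x \<in> {0..1}" for n x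
    using f(1)[of n] by (auto simp: continuous_map_in_subtopology Pi_iff)
  define h where "h x = (\<Sum>n. (1/2) ^ n * f n x)" for x
  have geo: "summable (\<lambda>n. (1/2::real) ^ n)" by (intro summable_geometric) simp
  have le: "norm ((1/2) ^ n * f n x) \<le> (1/2) ^ n" if "x \<in> topspace X" for n x
    using f01[OF that, of n] by (simp add: abs_mult mult_left_le)
  have "uniform_limit (topspace X) (\<lambda>N x. \<Sum>n<N. (1/2) ^ n * f n x) h sequentially"
    unfolding h_def[abs_def] by (rule Weierstrass_m_test[OF le geo])
  then have "continuous_map X Met_TC.mtopology h"
    by (intro Met_TC.continuous_map_uniform_limit
          [where F = sequentially and f = "\<lambda>N x. \<Sum>n<N. (1/2) ^ n * f n x"])
      (auto simp: uniform_limit_iff intro!: always_eventually continuous_map_sum continuous_map_real_mult_left fc)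
  moreover have "h a = 0" by (simp add: h_def f(2))
  moreover have "h (s n) > 0" for n
  proof -
    have sn: "s n \<in> topspace X" using s by auto
    have "summable (\<lambda>k. (1/2) ^ k * f k (s n))"
      by (rule summable_comparison_test'[OF geo, of 0]) (use le[OF sn] in auto)
    then show ?thesis
      unfolding h_def using f01[OF sn] f(3)[of n] by (intro suminf_pos2[of _ n]) auto
  qed
  ultimately show ?thesis using that by simp
qed

lemma sequence_rapidly_decreasing_subsequence:
  fixes t :: "nat \<Rightarrow> real"
  assumes pos: "\<And>n. t n > 0" and lim: "t \<longlonglongrightarrow> 0"
  obtains r :: "nat \<Rightarrow> nat" where "strict_mono r" "\<And>k. 3 * t (r (Suc k)) \<le> t (r k)"
proof -
  have "\<exists>m. n < m \<and> 3 * t m \<le> t n" for n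
  proof -
    have "eventually (\<lambda>m. t m < t n / 3) sequentially"
      using lim pos[of n] by (intro order_tendstoD) auto
    then have "eventually (\<lambda>m. n < m \<and> t m < t n / 3) sequentially"
      using eventually_gt_at_top by (rule eventually_conj[rotated])
    then obtain m where "n < m" "t m < t n / 3" using eventually_happens by fastforce
    then show ?thesis by (intro exI[of _ m]) auto
  qed
  then have "\<exists>r. \<forall>k. r k < r (Suc k) \<and> 3 * t (r (Suc k)) \<le> t (r k)"
    using dependent_nat_choice[of "\<lambda>_ _. True" "\<lambda>_ n m. n < m \<and> 3 * t m \<le> t n"] by auto
  then show ?thesis using that strict_mono_Suc_iff by blast
qed

theorem convergent_sequence_imp_not_sequential_Dunford_Pettis:
  fixes s :: "nat \<Rightarrow> 'a"
  assumes X: "tychonoff_space X" and fL: "free_lcs X L i"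
    and s: "range s \<subseteq> topspace X - {a}" "limitin X s a sequentially"
  shows "\<not> sequential_Dunford_Pettis L"
proof -
  have L: "lcs L" and i: "continuous_map X L i" using fL by (auto simp: free_lcs_def)
  have a: "a \<in> topspace X" using s(2) limitin_topspace by metis
  obtain h where h: "continuous_map X euclideanreal h" "h a = 0" "\<And>n. h (s n) > 0"
    using continuous_function_separating_sequence[OF X a s(1)] by metis
  have "(\<lambda>n. h (s n)) \<longlonglongrightarrow> 0"
    using continuous_map_limit[OF h(1) s(2)] h(2) by (simp add: o_def)
  then obtain r :: "nat \<Rightarrow> nat" where r: "strict_mono r" "\<And>k. 3 * h (s (r (Suc k))) \<le> h (s (r k))"
    using sequence_rapidly_decreasing_subsequence[of "\<lambda>n. h (s n)"] h(3) by metis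
  obtain g :: "nat \<Rightarrow> real \<Rightarrow>\<^sub>C real" where g: "\<And>k. g k (h (s (r k))) = 1" "\<And>k. g k 0 = 0"
    "\<And>\<epsilon> N. (\<And>k. \<bar>\<epsilon> k\<bar> \<le> 1) \<Longrightarrow> norm (\<Sum>k<N. \<epsilon> k *\<^sub>R g k) \<le> 1"
    using disjoint_tents[of "\<lambda>k. h (s (r k))"] h(3) r(2) by metis
  define \<xi> where "\<xi> k = free_extension X L i (apply_bcontfun (g k) \<circ> h)" for k
  define x where "x k = i (s (r k)) + (-1) *\<^sub>R i a" for k
  have cont: "continuous_map X euclideanreal (apply_bcontfun (g k) \<circ> h)" for k
    by (rule continuous_map_compose[OF h(1)]) simp
  note \<xi> = free_extension[OF fL cont, folded \<xi>_def]
  have iL: "i p \<in> topspace L" if "p \<in> topspace X" for p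
    using i that by (auto simp: continuous_map_def)
  have sX: "s n \<in> topspace X" for n using s(1) by auto
  have sub: "subspace (topspace L)" using L by (simp add: lcs_def)
  have neg: "(-1) *\<^sub>R i a \<in> topspace L" using sub iL[OF a] by (rule subspace_scale)
  have f_x: "f (x k) = f (i (s (r k))) - f (i a)" if "f \<in> dual L" for f k
  proof -
    have "f (x k) = f (i (s (r k))) + f ((-1) *\<^sub>R i a)"
      using that iL[OF sX] neg unfolding x_def dual_iff by blast
    also have "f ((-1) *\<^sub>R i a) = (-1) * f (i a)" using that iL[OF a] unfolding dual_iff by blast
    finally show ?thesis by simp
  qed
  have "weakly_null L x"
    unfolding weakly_null_iff[OF L]
  proof (intro conjI ballI)
    show "range x \<subseteq> topspace L"
      unfolding x_def using subspace_add[OF sub iL[OF sX] neg] by blast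
    fix f assume f: "f \<in> dual L"
    have "continuous_map X euclideanreal (f \<circ> i)"
      using f by (intro continuous_map_compose[OF i]) (simp add: dual_iff)
    then have "(\<lambda>n. f (i (s n))) \<longlonglongrightarrow> f (i a)"
      using continuous_map_limit[OF _ s(2)] by (fastforce simp: o_def)
    then have "(\<lambda>k. f (i (s (r k)))) \<longlonglongrightarrow> f (i a)"
      using LIMSEQ_subseq_LIMSEQ[OF _ r(1)] by (fastforce simp: o_def)
    then show "(\<lambda>k. f (x k)) \<longlonglongrightarrow> 0"
      unfolding f_x[OF f] by (rule LIM_zero)
  qed
  moreover have "weakly_null (strong_dual L) \<xi>"
    unfolding weakly_null_iff[OF lcs_strong_dual[OF L]]
  proof (intro conjI ballI)
    show "range \<xi> \<subseteq> topspace (strong_dual L)" using \<xi>(1) by auto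
    fix \<phi> assume "\<phi> \<in> dual (strong_dual L)"
    from bounded_linear_tendsto_zero_of_bounded_signed_sums[OF bidual_comp_bounded_linear[OF fL h(1) this] g(3)]
    show "(\<lambda>k. \<phi> (\<xi> k)) \<longlonglongrightarrow> 0" by (simp add: \<xi>_def)
  qed
  moreover have "\<xi> k (x k) = 1" for k
    using f_x[OF \<xi>(1)] \<xi>(2)[OF sX] \<xi>(2)[OF a] g(1,2) h(2) by simp
  then have "\<not> (\<lambda>k. \<xi> k (x k)) \<longlonglongrightarrow> 0"
    by (simp add: LIMSEQ_const_iff)
  ultimately show ?thesis unfolding sequential_Dunford_Pettis_def by blast
qed

theorem theorem1p7:
  fixes X :: "'a topology" and L :: "'v::real_vector topology" and i :: "'a \<Rightarrow> 'v"
  assumes "tychonoff_space X" and "sequential_space X" and "mu_space X"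
    and "free_lcs X L i"
  shows "sequential_Dunford_Pettis L \<longleftrightarrow> X = discrete_topology (topspace X)"
proof
  assume DP: "sequential_Dunford_Pettis L"
  have "openin X {a}" if a: "a \<in> topspace X" for a
  proof (rule ccontr)
    assume "\<not> openin X {a}"
    then have "\<not> closedin X (topspace X - {a})" using a by (simp add: closedin_def Diff_Diff_Int)
    then obtain s b where s: "range s \<subseteq> topspace X - {a}" "limitin X s b sequentially"
      and b: "b \<in> X closure_of (topspace X - {a}) - (topspace X - {a})"
      using assms(2) unfolding sequential_space_def by (metis Diff_subset)
    have "b = a" using b in_closure_of by fastforce
    then show False
      using convergent_sequence_imp_not_sequential_Dunford_Pettis[OF assms(1,4)] s DP by blast
  qed
  then show "X = discrete_topology (topspace X)" using discrete_topology_unique by metis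
next
  assume "X = discrete_topology (topspace X)"
  then show "sequential_Dunford_Pettis L"
    using discrete_imp_sequential_Dunford_Pettis assms(4) by blast
qed

end
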